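(* Let $\mathfrak{M}$ be a one-dimensional manifold and $\mathfrak{N}$ a two-dimensional manifold, and let $f$ be a metric (two-point) function assigning to some pairs $\langle i\alpha\rangle\in\mathfrak{M}\times\mathfrak{N}$ a real number $f(i\alpha)$. If $f$ gives on $\mathfrak{M}$ and $\mathfrak{N}$ a phenomenologically symmetric geometry of two sets of rank $(3,2)$, i.e. if axioms A1--A4 of the context are satisfied, then, with an accuracy up to a change of coordinates in the manifolds $\mathfrak{M}$ and $\mathfrak{N}$ and a scaling transformation of $f$, the coordinate representation $f=f(x,\xi,\eta)$ of the metric function may be written in the canonical form $$f = x\xi+\eta .$$
   Context: Points of $\mathfrak{M}$ are denoted by lowercase Latin letters $i,j,k$, points of $\mathfrak{N}$ by lowercase Greek letters $\alpha,\beta$. If $x$ is a local coordinate in $\mathfrak{M}$ and $\xi,\eta$ are local coordinates in $\mathfrak{N}$, the metric function has the coordinate representation $f=f(x,\xi,\eta)$, so that $f(i\alpha)=f(x_i,\xi_\alpha,\eta_\alpha)$, where $x_i$ is the coordinate of $i$ and $\xi_\alpha,\eta_\alpha$ are the coordinates of $\alpha$. The function $f$ gives on $\mathfrak{M}$ and $\mathfrak{N}$ a *phenomenologically symmetric geometry of two sets (PS G2S) of rank $(3,2)$* if the following four axioms are satisfied. A1. The domain of $f$ is open and dense in $\mathfrak{M}\times\mathfrak{N}$. A2. The function $f$ is sufficiently smooth. A3. The local coordinates $x$ and $\xi,\eta$ are included in the representation $f=f(x,\xi,\eta)$ in an essential way. This is expressed mathematically by the inequalities $$\frac{\partial f(x,\xi,\eta)}{\partial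 x}\neq 0,\qquad \frac{\partial\bigl(f(x_1,\xi,\eta),f(x_2,\xi,\eta)\bigr)}{\partial(\xi,\eta)}\neq 0\quad\text{if } x_1\neq x_2,$$ that is, written for points of the manifolds, $\partial f(x_i,\xi_\alpha,\eta_\alpha)/\partial x_i\neq 0$ and $\partial\bigl(f(x_j,\xi_\alpha,\eta_\alpha),f(x_k,\xi_\alpha,\eta_\alpha)\bigr)/\partial(\xi_\alpha,\eta_\alpha)\neq 0$ if $j\neq k$. A4. Let $F$ be the function assigning to a tuple $\langle ijk,\alpha\beta\rangle\in\mathfrak{M}^3\times\mathfrak{N}^2$ the point $$\bigl(f(i\alpha),f(i\beta),f(j\alpha),f(j\beta),f(k\alpha),f(k\beta)\bigr)\in\mathbb{R}^6 .$$ The set of values of $F$ lies in $\mathbb{R}^6$ on a smooth non-degenerate hypersurface $$\Phi\bigl(f(i\alpha),f(i\beta),f(j\alpha),f(j\beta),f(k\alpha),f(k\beta)\bigr)=0 .$$ A *scaling transformation* of $f$ is a replacement $\chi^{-1}(f)\to f$, where $\chi^{-1}$ is the inverse of a function $\chi$ of one variable with nonzero derivative. *)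

theory Defs
  imports "HOL-Analysis.Analysis"
begin

section \<open>Functions and manifolds of class $C^r$\<close>

text \<open>
  Class $C^k$ on an open set: all iterated directional derivatives up to order $k$ exist (as
  Frechet derivatives) and are continuous. The definition is only meant for open \<open>S\<close>, since
  \<open>at x\<close> refers to a full neighbourhood of \<open>x\<close>.
\<close>

primrec Ck_on :: "nat \<Rightarrow> 'a::euclidean_space set \<Rightarrow> ('a \<Rightarrow> 'b::euclidean_space) \<Rightarrow> bool" where
  "Ck_on 0 S f \<longleftrightarrow> continuous_on S f"
| "Ck_on (Suc k) S f \<longleftrightarrow>
     (\<forall>x\<in>S. f differentiable (at x)) \<and>
     (\<forall>v. Ck_on k S (\<lambda>x. frechet_derivative f (at x) v))"

text \<open>The order \<open>r\<close> ranges over the extended naturals, so that $C^\infty$ is included.\<close>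

definition Cr_on :: "enat \<Rightarrow> 'a::euclidean_space set \<Rightarrow> ('a \<Rightarrow> 'b::euclidean_space) \<Rightarrow> bool" where
  "Cr_on r S f \<longleftrightarrow> (\<forall>k. enat k \<le> r \<longrightarrow> Ck_on k S f)"

text \<open>
  A chart is a pair of a coordinate domain and a coordinate map; only the values of the map on
  the domain are relevant. The model space \<open>'e\<close> fixes the dimension of the manifold.
\<close>

type_synonym ('m, 'e) chart = "'m set \<times> ('m \<Rightarrow> 'e)"

definition is_chart :: "('m::topological_space, 'e::euclidean_space) chart \<Rightarrow> bool" where
  "is_chart = (\<lambda>(U, \<phi>). open U \<and> open (\<phi> ` U) \<and> inj_on \<phi> U \<and>
     homeomorphism U (\<phi> ` U) \<phi> (the_inv_into U \<phi>))"

definition Cr_transition ::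
  "enat \<Rightarrow> ('m, 'e::euclidean_space) chart \<Rightarrow> ('m, 'e) chart \<Rightarrow> bool" where
  "Cr_transition r = (\<lambda>(U, \<phi>) (V, \<psi>). Cr_on r (\<phi> ` (U \<inter> V)) (\<psi> \<circ> the_inv_into U \<phi>))"

definition Cr_compatible ::
  "enat \<Rightarrow> ('m, 'e::euclidean_space) chart \<Rightarrow> ('m, 'e) chart \<Rightarrow> bool" where
  "Cr_compatible r c d \<longleftrightarrow> Cr_transition r c d \<and> Cr_transition r d c"

text \<open>
  The underlying set of the manifold is the whole type \<open>'m\<close> with its class topology; the
  manifold structure is given by an atlas.
\<close>

definition Cr_atlas ::
  "enat \<Rightarrow> ('m::{t2_space,second_countable_topology}, 'e::euclidean_space) chart set \<Rightarrow> bool" where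
  "Cr_atlas r A \<longleftrightarrow>
     (\<forall>c\<in>A. is_chart c) \<and> (\<Union>c\<in>A. fst c) = UNIV \<and> (\<forall>c\<in>A. \<forall>d\<in>A. Cr_compatible r c d)"

text \<open>Admissible local coordinates, i.e. the charts of the maximal atlas generated by \<open>A\<close>.\<close>

definition local_coords ::
  "enat \<Rightarrow> ('m::{t2_space,second_countable_topology}, 'e::euclidean_space) chart set
    \<Rightarrow> ('m, 'e) chart \<Rightarrow> bool" where
  "local_coords r A c \<longleftrightarrow> is_chart c \<and> (\<forall>d\<in>A. Cr_compatible r c d)"


section \<open>Phenomenologically symmetric geometry of two sets of rank (3,2)\<close>

text \<open>The coordinate representation $f(x,\xi,\eta)$ of the metric function in given charts.\<close>

definition coord_rep ::
  "('m, real) chart \<Rightarrow> ('n, real \<times> real) chart \<Rightarrow> ('m \<Rightarrow> 'n \<Rightarrow> real)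
    \<Rightarrow> real \<times> real \<times> real \<Rightarrow> real" where
  "coord_rep = (\<lambda>(U, \<phi>) (V, \<psi>) f (x, \<xi>, \<eta>).
     f (the_inv_into U \<phi> x) (the_inv_into V \<psi> (\<xi>, \<eta>)))"

definition coord_dom ::
  "('m, real) chart \<Rightarrow> ('n, real \<times> real) chart \<Rightarrow> ('m \<times> 'n) set \<Rightarrow> (real \<times> real \<times> real) set" where
  "coord_dom = (\<lambda>(U, \<phi>) (V, \<psi>) D. map_prod \<phi> \<psi> ` (D \<inter> U \<times> V))"

text \<open>The Jacobian determinant $\partial(g,h)/\partial(\xi,\eta)$.\<close>

definition jacobian2 ::
  "(real \<Rightarrow> real \<Rightarrow> real) \<Rightarrow> (real \<Rightarrow> real \<Rightarrow> real) \<Rightarrow> real \<Rightarrow> real \<Rightarrow> real" where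
  "jacobian2 g h \<xi> \<eta> =
     deriv (\<lambda>s. g s \<eta>) \<xi> * deriv (\<lambda>t. h \<xi> t) \<eta> - deriv (\<lambda>t. g \<xi> t) \<eta> * deriv (\<lambda>s. h s \<eta>) \<xi>"

text \<open>
  \<open>f\<close> is a partial function with domain \<open>D\<close>; its values outside \<open>D\<close> are irrelevant.
\<close>

definition axiom_A1 :: "('m::topological_space \<times> 'n::topological_space) set \<Rightarrow> bool" where
  "axiom_A1 D \<longleftrightarrow> open D \<and> closure D = UNIV"

definition axiom_A2 ::
  "enat \<Rightarrow> ('m, real) chart set \<Rightarrow> ('n, real \<times> real) chart set
    \<Rightarrow> ('m \<times> 'n) set \<Rightarrow> ('m \<Rightarrow> 'n \<Rightarrow> real) \<Rightarrow> bool" where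
  "axiom_A2 r A B D f \<longleftrightarrow> (\<forall>c\<in>A. \<forall>d\<in>B. Cr_on r (coord_dom c d D) (coord_rep c d f))"

text \<open>
  In the second condition the points \<open>j\<close> and \<open>k\<close> need not lie in a common chart, so their
  coordinates are taken in charts of their own.
\<close>

definition axiom_A3 ::
  "('m, real) chart set \<Rightarrow> ('n, real \<times> real) chart set
    \<Rightarrow> ('m \<times> 'n) set \<Rightarrow> ('m \<Rightarrow> 'n \<Rightarrow> real) \<Rightarrow> bool" where
  "axiom_A3 A B D f \<longleftrightarrow>
     (\<forall>c\<in>A. \<forall>d\<in>B. \<forall>(x, \<xi>, \<eta>)\<in>coord_dom c d D.
        deriv (\<lambda>t. coord_rep c d f (t, \<xi>, \<eta>)) x \<noteq> 0) \<and>
     (\<forall>(U, \<phi>)\<in>A. \<forall>(U', \<phi>')\<in>A. \<forall>(V, \<psi>)\<in>B. \<forall>j\<in>U. \<forall>k\<in>U'. \<forall>\<alpha>\<in>V.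
        j \<noteq> k \<and> (j, \<alpha>) \<in> D \<and> (k, \<alpha>) \<in> D \<longrightarrow>
        jacobian2 (\<lambda>\<xi> \<eta>. coord_rep (U, \<phi>) (V, \<psi>) f (\<phi> j, \<xi>, \<eta>))
                  (\<lambda>\<xi> \<eta>. coord_rep (U', \<phi>') (V, \<psi>) f (\<phi>' k, \<xi>, \<eta>))
                  (fst (\<psi> \<alpha>)) (snd (\<psi> \<alpha>)) \<noteq> 0)"

text \<open>The function $F$ and its natural domain; $\mathbb{R}^6$ is an iterated product.\<close>

type_synonym R6 = "real \<times> real \<times> real \<times> real \<times> real \<times> real"

definition F_map :: "('m \<Rightarrow> 'n \<Rightarrow> real) \<Rightarrow> 'm \<times> 'm \<times> 'm \<times> 'n \<times> 'n \<Rightarrow> R6" where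
  "F_map f = (\<lambda>(i, j, k, \<alpha>, \<beta>). (f i \<alpha>, f i \<beta>, f j \<alpha>, f j \<beta>, f k \<alpha>, f k \<beta>))"

definition F_dom :: "('m \<times> 'n) set \<Rightarrow> ('m \<times> 'm \<times> 'm \<times> 'n \<times> 'n) set" where
  "F_dom D = {(i, j, k, \<alpha>, \<beta>). {i, j, k} \<times> {\<alpha>, \<beta>} \<subseteq> D}"

text \<open>
  The values of $F$ lie on the hypersurface $\Phi = 0$. Non-degeneracy means that the gradient of
  $\Phi$ is nonzero at the values of $F$ on a dense set of tuples. It cannot be required at all
  tuples. Already for $f = x\xi + \eta$, take $i = j = k$ with value $(p, q, p, q, p, q)$; moving
  $i$ alone gives $\xi_\alpha \Phi_1 + \xi_\beta \Phi_2 = 0$, where $p, q$ being fixed the ratio of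
  $\xi_\alpha$ and $\xi_\beta$ is still arbitrary, so $\Phi_1 = \Phi_2 = 0$, and likewise for the
  other partial derivatives. On distinct points the relation for this $f$ is the vanishing of the
  determinant with rows $(f(i\alpha), f(i\beta), 1)$, $(f(j\alpha), f(j\beta), 1)$,
  $(f(k\alpha), f(k\beta), 1)$, whose gradient vanishes only if $i = j = k$ (for $\xi \neq 0$).
\<close>

definition axiom_A4 ::
  "enat \<Rightarrow> ('m::topological_space \<times> 'n::topological_space) set \<Rightarrow> ('m \<Rightarrow> 'n \<Rightarrow> real) \<Rightarrow> bool" where
  "axiom_A4 r D f \<longleftrightarrow>
     (\<exists>W (\<Phi> :: R6 \<Rightarrow> real).
        open W \<and> F_map f ` F_dom D \<subseteq> W \<and> Cr_on r W \<Phi> \<and>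
        (\<forall>t\<in>F_dom D. \<Phi> (F_map f t) = 0) \<and>
        F_dom D \<subseteq> closure {t \<in> F_dom D. frechet_derivative \<Phi> (at (F_map f t)) \<noteq> (\<lambda>_. 0)})"

definition PS_G2S_3_2 ::
  "enat \<Rightarrow> ('m::{t2_space,second_countable_topology}, real) chart set
    \<Rightarrow> ('n::{t2_space,second_countable_topology}, real \<times> real) chart set
    \<Rightarrow> ('m \<times> 'n) set \<Rightarrow> ('m \<Rightarrow> 'n \<Rightarrow> real) \<Rightarrow> bool" where
  "PS_G2S_3_2 r A B D f \<longleftrightarrow>
     axiom_A1 D \<and> axiom_A2 r A B D f \<and> axiom_A3 A B D f \<and> axiom_A4 r D f"

text \<open>
  A scaling replaces \<open>f\<close> by \<open>the_inv_into J h \<circ> f\<close>; on an interval the nonvanishing derivative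
  makes \<open>h\<close> injective.
\<close>

definition scaling_function :: "enat \<Rightarrow> real set \<Rightarrow> (real \<Rightarrow> real) \<Rightarrow> bool" where
  "scaling_function r J h \<longleftrightarrow>
     open J \<and> is_interval J \<and> Cr_on r J h \<and> (\<forall>s\<in>J. deriv h s \<noteq> 0)"

end

theory Submission
  imports Defs
begin

text \<open>
  In coordinates, let the slope of \<open>f\<close> at \<open>(x, a)\<close> be the covector $v_x(a) = \partial_a f / \partial_x f$
  and $[x y](a) = \det (v_x(a), v_y(a))$. Differentiating $\Phi = 0$ shows that the gradient of
  $\Phi$ gives one and the same linear relation between $v_i, v_j, v_k$ at $\alpha$ and at $\beta$, so
  the ratios of the minors $[j k], [k i], [i j]$ do not depend on the point of $\mathfrak{N}$. Hence
  $v_x(a) = l(x) v_j(a) + m(x) v_k(a)$ for fixed \<open>j \<noteq> k\<close>. Symmetry of the second derivatives of \<open>f\<close>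
  turns into a Wronskian equation $l m' - m l' = c_1 l + c_2 m$, which produces a coordinate
  \<open>X = (d\<^sub>1 l + d\<^sub>2 m) / (c\<^sub>1 l + c\<^sub>2 m)\<close> on $\mathfrak{M}$ in which the slopes are affine. The
  characteristics of $\partial_a f = \partial_X f \cdot (e_0(a) + X e_1(a))$ are then affine in \<open>X\<close>, so
  $f(X, a) = h(\xi(a) X + \eta(a))$ with \<open>h = f(\<cdot>, a\<^sub>0)\<close>, and \<open>h\<close> is the scaling. Since $\xi$ and
  $\eta$ are read off from \<open>h\<^sup>-\<^sup>1 \<circ> f\<close> at two values of \<open>X\<close>, they are as smooth as \<open>f\<close>; their
  differentials at \<open>a\<^sub>0\<close> are $e_1$ and $e_0$, which are independent.
\<close>

section \<open>Calculus of class $C^k$ maps\<close>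

text \<open>The common linear relation comes from moving \<open>i\<close> alone: this gives f_x(i,
  \<alpha>) \<Phi>_1 + f_x(i, \<beta>) \<Phi>_2 = 0, so the weight that the gradient gives to the
  slope of \<open>i\<close> at \<beta> is minus its weight at \<alpha>, and likewise for
  \<open>j\<close> and \<open>k\<close>. In the Wronskian equation c_1 and c_2 are the curls at
  \<open>a0\<close> of the covector fields v_j and v_k, divided by [j k](a0). The delicate point is
  that C = c_1 l + c_2 m, the denominator of X, must have no zero. The Wronskian equation makes
  every zero of C non-isolated, whereas two zeros would make the slopes of two distinct points
  parallel, against A3. The constants d_1, d_2 are normalised by c_1 d_2 - c_2 d_1 = 1, which gives
  X' = 1 / C; since the slopes are C times an affine function of X, passing to the coordinate X
  removes the factor C. A second obstacle is smoothness: slopes are one order less smooth than f. X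
  regains the lost order because its derivative is 1 / C, and the pair (\<xi>, \<eta>), although
  produced by integrating slopes, is recovered from values of f itself.\<close>

lemma Ck_on_cong:
  assumes "open S" "\<And>x. x \<in> S \<Longrightarrow> f x = g x" "Ck_on k S f"
  shows "Ck_on k S g"
  using assms(2,3)
proof (induction k arbitrary: f g)
  case 0
  then show ?case using continuous_on_cong by fastforce
next
  case (Suc k)
  have d: "f differentiable (at x)" if "x \<in> S" for x using Suc that by simp
  have "g differentiable (at x)" if "x \<in> S" for x
    by (metis d[OF that] differentiable_def has_derivative_transform_within_open assms(1) Suc.prems(1) that)
  moreover have "Ck_on k S (\<lambda>x. frechet_derivative g (at x) v)" for v
  proof (rule Suc.IH)
    show "frechet_derivative f (at x) v = frechet_derivative g (at x) v" if "x \<in> S" for x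
      using frechet_derivative_transform_within_open[OF d[OF that] assms(1) that Suc.prems(1)] by simp
    show "Ck_on k S (\<lambda>x. frechet_derivative f (at x) v)" using Suc by simp
  qed
  ultimately show ?case by simp
qed

lemma Ck_on_subset: "Ck_on k S f \<Longrightarrow> T \<subseteq> S \<Longrightarrow> Ck_on k T f"
  by (induction k arbitrary: f) (auto intro: continuous_on_subset)

lemma Ck_on_SucD: "Ck_on (Suc k) S f \<Longrightarrow> Ck_on k S f"
proof (induction k arbitrary: f)
  case 0
  then show ?case
    by (auto intro!: continuous_at_imp_continuous_on differentiable_imp_continuous_within)
next
  case (Suc k)
  then have "\<forall>x\<in>S. f differentiable (at x)"
    and "\<And>v. Ck_on (Suc k) S (\<lambda>x. frechet_derivative f (at x) v)"
    unfolding Ck_on.simps(2)[of "Suc k"] by blast+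
  then show ?case using Suc.IH unfolding Ck_on.simps(2)[of k] by blast
qed

lemma Ck_on_mono: "Ck_on k S f \<Longrightarrow> j \<le> k \<Longrightarrow> Ck_on j S f"
proof (induction k)
  case (Suc k) then show ?case using Ck_on_SucD by (metis le_SucE)
qed simp

lemma Ck_on_imp_continuous_on: "Ck_on k S f \<Longrightarrow> continuous_on S f"
  using Ck_on_mono[of k S f 0] by simp

text \<open>Lets the derivative be supplied in closed form: derivatives are unique, so the supplied
  one agrees with the chosen \<open>frechet_derivative\<close> on the open set, and
  \<open>Ck_on_cong\<close> transfers the smoothness.\<close>

lemma Ck_on_SucI:
  assumes "open S" "\<And>x. x \<in> S \<Longrightarrow> (f has_derivative f' x) (at x)"
    and "\<And>v. Ck_on k S (\<lambda>x. f' x v)"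
  shows "Ck_on (Suc k) S f"
proof -
  have "f' x v = frechet_derivative f (at x) v" if "x \<in> S" for x v
    using assms(2)[OF that] frechet_derivative_at by metis
  then have "Ck_on k S (\<lambda>x. frechet_derivative f (at x) v)" for v
    by (rule Ck_on_cong[OF assms(1) _ assms(3)[of v]])
  then show ?thesis using assms(2) by (auto simp: differentiable_def)
qed

lemma Ck_on_SucE:
  assumes "Ck_on (Suc k) S f" "x \<in> S"
  shows "(f has_derivative frechet_derivative f (at x)) (at x)"
  using assms by (simp add: frechet_derivative_works)

lemma Ck_on_const: "Ck_on k S (\<lambda>x. c)"
  by (induction k arbitrary: c) auto

lemma Ck_on_linear:
  assumes "bounded_linear L"
  shows "Ck_on k S L"
proof (cases k)
  case 0 then show ?thesis using assms by (simp add: linear_continuous_on)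
next
  case (Suc j)
  have "frechet_derivative L (at x) = L" for x
    using bounded_linear_imp_has_derivative[OF assms] frechet_derivative_at by metis
  then show ?thesis
    using Suc bounded_linear_imp_differentiable[OF assms] by (simp add: Ck_on_const)
qed

lemma Ck_on_linear_compose:
  assumes "bounded_linear L" "open S" "Ck_on k S f"
  shows "Ck_on k S (\<lambda>x. L (f x))"
  using assms(3)
proof (induction k arbitrary: f)
  case 0 then show ?case
    using bounded_linear.continuous_on[OF assms(1)] by auto
next
  case (Suc k)
  show ?case
  proof (rule Ck_on_SucI[OF assms(2)])
    show "((\<lambda>x. L (f x)) has_derivative (\<lambda>v. L (frechet_derivative f (at x) v))) (at x)"
      if "x \<in> S" for x
      using bounded_linear.has_derivative[OF assms(1) Ck_on_SucE[OF Suc.prems that]] .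
    show "Ck_on k S (\<lambda>x. L (frechet_derivative f (at x) v))" for v
      using Suc by simp
  qed
qed

lemma Ck_on_add:
  assumes "open S" "Ck_on k S f" "Ck_on k S g"
  shows "Ck_on k S (\<lambda>x. f x + g x)"
  using assms(2,3)
proof (induction k arbitrary: f g)
  case 0 then show ?case by (auto intro: continuous_intros)
next
  case (Suc k)
  show ?case
  proof (rule Ck_on_SucI[OF assms(1)])
    show "((\<lambda>x. f x + g x) has_derivative
        (\<lambda>v. frechet_derivative f (at x) v + frechet_derivative g (at x) v)) (at x)"
      if "x \<in> S" for x
      using has_derivative_add[OF Ck_on_SucE[OF Suc.prems(1) that] Ck_on_SucE[OF Suc.prems(2) that]] .
  qed (use Suc in simp)
qed

lemma Ck_on_sum:
  assumes "open S" "\<And>i. i \<in> I \<Longrightarrow> Ck_on k S (f i)"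
  shows "Ck_on k S (\<lambda>x. \<Sum>i\<in>I. f i x)"
  using assms(2)
  by (induction I rule: infinite_finite_induct) (auto intro: Ck_on_const Ck_on_add assms(1))

lemma Ck_on_bilinear:
  assumes "bounded_bilinear B" "open S" "Ck_on k S f" "Ck_on k S g"
  shows "Ck_on k S (\<lambda>x. B (f x) (g x))"
  using assms(3,4)
proof (induction k arbitrary: f g)
  case 0 then show ?case using bounded_bilinear.continuous_on[OF assms(1)] by auto
next
  case (Suc k)
  note f = Ck_on_SucD[OF Suc.prems(1)] and g = Ck_on_SucD[OF Suc.prems(2)]
  show ?case
  proof (rule Ck_on_SucI[OF assms(2)])
    show "((\<lambda>x. B (f x) (g x)) has_derivative
        (\<lambda>v. B (f x) (frechet_derivative g (at x) v) + B (frechet_derivative f (at x) v) (g x))) (at x)"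
      if "x \<in> S" for x
      using bounded_bilinear.FDERIV[OF assms(1) Ck_on_SucE[OF Suc.prems(1) that] Ck_on_SucE[OF Suc.prems(2) that]] .
    show "Ck_on k S (\<lambda>x. B (f x) (frechet_derivative g (at x) v) + B (frechet_derivative f (at x) v) (g x))" for v
      using Suc.prems by (intro Ck_on_add[OF assms(2)] Suc.IH f g) simp_all
  qed
qed

lemma Ck_on_mult:
  fixes f g :: "_ \<Rightarrow> real"
  shows "open S \<Longrightarrow> Ck_on k S f \<Longrightarrow> Ck_on k S g \<Longrightarrow> Ck_on k S (\<lambda>x. f x * g x)"
  by (rule Ck_on_bilinear[OF bounded_bilinear_mult])

lemma Ck_on_uminus: "open S \<Longrightarrow> Ck_on k S f \<Longrightarrow> Ck_on k S (\<lambda>x. - f x)"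
  by (rule Ck_on_linear_compose[OF bounded_linear_minus[OF bounded_linear_ident]])

lemma Ck_on_diff: "open S \<Longrightarrow> Ck_on k S f \<Longrightarrow> Ck_on k S g \<Longrightarrow> Ck_on k S (\<lambda>x. f x - g x)"
  using Ck_on_add[of S k f "\<lambda>x. - g x"] Ck_on_uminus[of S k g] by simp

lemma Ck_on_Pair:
  fixes f :: "'a::euclidean_space \<Rightarrow> 'b::euclidean_space" and g :: "'a \<Rightarrow> 'c::euclidean_space"
  assumes "open S" "Ck_on k S f" "Ck_on k S g"
  shows "Ck_on k S (\<lambda>x. (f x, g x))"
proof -
  have "Ck_on k S (\<lambda>x. (f x, 0::'c) + (0::'b, g x))"
    by (intro Ck_on_add assms Ck_on_linear_compose[where L="\<lambda>y. (y, 0)"]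
        Ck_on_linear_compose[where L="\<lambda>y. (0, y)"] bounded_linear_intros)
  then show ?thesis by simp
qed

lemma Ck_on_fst: "open S \<Longrightarrow> Ck_on k S f \<Longrightarrow> Ck_on k S (\<lambda>x. fst (f x))"
  by (rule Ck_on_linear_compose[OF bounded_linear_fst])

lemma Ck_on_snd: "open S \<Longrightarrow> Ck_on k S f \<Longrightarrow> Ck_on k S (\<lambda>x. snd (f x))"
  by (rule Ck_on_linear_compose[OF bounded_linear_snd])

lemma Ck_on_ident: "Ck_on k S (\<lambda>x. x)"
  by (rule Ck_on_linear) (rule bounded_linear_ident)

text \<open>The chain rule evaluates the derivative of \<open>g\<close> in a direction that varies
  with the point, while \<open>Ck_on\<close> speaks of fixed directions. Expanding the direction in
  \<open>Basis\<close> gives a finite sum of products, and the induction hypothesis applies to each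
  fixed directional derivative of \<open>g\<close>.\<close>

lemma Ck_on_compose:
  fixes f :: "'a::euclidean_space \<Rightarrow> 'b::euclidean_space" and g :: "'b \<Rightarrow> 'c::euclidean_space"
  assumes "open S" "open T" "f ` S \<subseteq> T" "Ck_on k T g" "Ck_on k S f"
  shows "Ck_on k S (\<lambda>x. g (f x))"
  using assms(4,5)
proof (induction k arbitrary: g)
  case 0 then show ?case using assms(3) continuous_on_compose2 by fastforce
next
  case (Suc k)
  have fT: "f x \<in> T" if "x \<in> S" for x using that assms(3) by auto
  have exp: "frechet_derivative g (at (f x)) w = (\<Sum>b\<in>Basis. (w \<bullet> b) *\<^sub>R frechet_derivative g (at (f x)) b)"
    if "x \<in> S" for x w
  proof -
    have "linear (frechet_derivative g (at (f x)))"
      using Ck_on_SucE[OF Suc.prems(1) fT[OF that]] has_derivative_linear by blast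
    then have "frechet_derivative g (at (f x)) (\<Sum>b\<in>Basis. (w \<bullet> b) *\<^sub>R b) = (\<Sum>b\<in>Basis. (w \<bullet> b) *\<^sub>R frechet_derivative g (at (f x)) b)"
      by (simp add: linear_sum linear_scale)
    then show ?thesis by (simp only: euclidean_representation)
  qed
  show ?case
  proof (rule Ck_on_SucI[OF assms(1)])
    fix x assume "x \<in> S"
    show "((\<lambda>x. g (f x)) has_derivative
       (\<lambda>v. \<Sum>b\<in>Basis. (frechet_derivative f (at x) v \<bullet> b) *\<^sub>R frechet_derivative g (at (f x)) b)) (at x)"
      using has_derivative_compose[OF Ck_on_SucE[OF Suc.prems(2) \<open>x \<in> S\<close>] Ck_on_SucE[OF Suc.prems(1) fT[OF \<open>x \<in> S\<close>]]]
      by (simp add: exp[OF \<open>x \<in> S\<close>, symmetric])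
  next
    fix v
    show "Ck_on k S (\<lambda>x. \<Sum>b\<in>Basis. (frechet_derivative f (at x) v \<bullet> b) *\<^sub>R frechet_derivative g (at (f x)) b)"
    proof (intro Ck_on_sum[OF assms(1)] Ck_on_bilinear[OF bounded_bilinear_scaleR assms(1)])
      fix b :: 'b
      show "Ck_on k S (\<lambda>x. frechet_derivative f (at x) v \<bullet> b)"
        using Suc.prems(2)
        by (intro Ck_on_linear_compose[where L="\<lambda>y. y \<bullet> b"] bounded_linear_inner_left assms(1)) simp
      show "Ck_on k S (\<lambda>x. frechet_derivative g (at (f x)) b)"
        using Suc.prems(1) Ck_on_SucD[OF Suc.prems(2)] by (intro Suc.IH) simp_all
    qed
  qed
qed

text \<open>The derivative is built from products of the inverse itself, so each order of smoothness
  yields the next.\<close>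

lemma Ck_on_inverse: "Ck_on k (- {0}) (inverse :: real \<Rightarrow> real)"
proof (induction k)
  case 0 show ?case by (auto intro!: continuous_intros)
next
  case (Suc k)
  have o: "open (- {0::real})" by auto
  show ?case
    by (rule Ck_on_SucI[OF o has_derivative_inverse'])
      (auto intro!: Ck_on_mult o Ck_on_uminus Ck_on_const Suc)
qed

lemma Ck_on_divide:
  fixes f g :: "_ \<Rightarrow> real"
  assumes "open S" "Ck_on k S f" "Ck_on k S g" "\<And>x. x \<in> S \<Longrightarrow> g x \<noteq> 0"
  shows "Ck_on k S (\<lambda>x. f x / g x)"
proof -
  have "Ck_on k S (\<lambda>x. inverse (g x))"
    by (rule Ck_on_compose[OF assms(1) _ _ Ck_on_inverse assms(3)]) (use assms(4) in auto)
  then show ?thesis unfolding divide_inverse by (rule Ck_on_mult[OF assms(1,2)])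
qed

lemma Ck_on_Suc_real:
  fixes f :: "real \<Rightarrow> real"
  assumes "open S" "\<And>x. x \<in> S \<Longrightarrow> (f has_real_derivative f' x) (at x)" "Ck_on k S f'"
  shows "Ck_on (Suc k) S f"
  by (rule Ck_on_SucI[OF assms(1) assms(2)[unfolded has_field_derivative_def]])
    (auto intro!: Ck_on_mult assms Ck_on_const)

text \<open>The derivative of \<open>g\<close> is \<open>M \<circ> g\<close>, so \<open>g\<close> gains one order of smoothness at a time.\<close>

lemma Ck_on_inverse_map:
  fixes f :: "'a::euclidean_space \<Rightarrow> 'a"
  assumes o: "open S" "open T" and gT: "g ` T \<subseteq> S"
    and fg: "\<And>y. y \<in> T \<Longrightarrow> f (g y) = y" and cg: "continuous_on T g"
    and f': "\<And>x. x \<in> S \<Longrightarrow> (f has_derivative f' x) (at x)"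
    and M: "\<And>x. x \<in> S \<Longrightarrow> bounded_linear (M x)" "\<And>x v. x \<in> S \<Longrightarrow> M x (f' x v) = v"
    and kM: "\<And>v. Ck_on k S (\<lambda>x. M x v)"
  shows "Ck_on (Suc k) T g"
proof -
  have g': "(g has_derivative M (g y)) (at y)" if "y \<in> T" for y
  proof (rule has_derivative_inverse_basic[OF f' _ _ _ o(2) that fg])
    show "g y \<in> S" "bounded_linear (M (g y))" using gT that M(1) by auto
    show "M (g y) \<circ> f' (g y) = id" using gT that M(2) by fastforce
    show "continuous (at y) g" using cg that o(2) by (simp add: continuous_on_eq_continuous_at)
  qed
  have "Ck_on j T g" if "j \<le> Suc k" for j
    using that
  proof (induction j)
    case 0 then show ?case using cg by simp
  next
    case (Suc j)
    show ?case
    proof (rule Ck_on_SucI[OF o(2) g'])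
      show "Ck_on j T (\<lambda>y. M (g y) v)" for v
        by (rule Ck_on_compose[OF o(2,1) gT]) (use Suc Ck_on_mono[OF kM, of j] in auto)
    qed
  qed
  then show ?thesis by blast
qed

lemma Cr_on_subset: "Cr_on r S f \<Longrightarrow> T \<subseteq> S \<Longrightarrow> Cr_on r T f"
  by (auto simp: Cr_on_def intro: Ck_on_subset)

lemma Cr_on_cong: "open S \<Longrightarrow> (\<And>x. x \<in> S \<Longrightarrow> f x = g x) \<Longrightarrow> Cr_on r S f \<Longrightarrow> Cr_on r S g"
  unfolding Cr_on_def by (metis Ck_on_cong)

lemma Cr_on_compose:
  "open S \<Longrightarrow> open T \<Longrightarrow> f ` S \<subseteq> T \<Longrightarrow> Cr_on r T g \<Longrightarrow> Cr_on r S f \<Longrightarrow> Cr_on r S (\<lambda>x. g (f x))"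
  unfolding Cr_on_def by (metis Ck_on_compose)

lemma Cr_on_continuous_on: "Cr_on r S f \<Longrightarrow> continuous_on S f"
  unfolding Cr_on_def by (metis Ck_on.simps(1) enat_0 i0_lb)

text \<open>Derivative formulas are available at successor orders; as \<open>1 \<le> r\<close>,
  order 0 is inherited from order 1.\<close>

lemma Cr_onI:
  assumes "\<And>k. enat (Suc k) \<le> r \<Longrightarrow> Ck_on (Suc k) S f" "1 \<le> r"
  shows "Cr_on r S f"
  unfolding Cr_on_def
proof (intro allI impI)
  fix k assume "enat k \<le> r"
  have "Ck_on (Suc 0) S f" using assms by (metis One_nat_def one_enat_def)
  then show "Ck_on k S f" using assms(1)[of "k - 1"] \<open>enat k \<le> r\<close> Ck_on_SucD[of 0] by (cases k) simp_all
qed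

section \<open>Symmetry of second derivatives\<close>

lemma has_real_derivative_along_line:
  fixes f :: "'a::real_normed_vector \<Rightarrow> real"
  assumes "f differentiable (at (x + t *\<^sub>R v))"
  shows "((\<lambda>t. f (x + t *\<^sub>R v)) has_real_derivative frechet_derivative f (at (x + t *\<^sub>R v)) v) (at t)"
proof -
  let ?D = "frechet_derivative f (at (x + t *\<^sub>R v))"
  have D: "(f has_derivative ?D) (at (x + t *\<^sub>R v))" using assms by (simp add: frechet_derivative_works)
  have "((\<lambda>t. x + t *\<^sub>R v) has_derivative (\<lambda>s. s *\<^sub>R v)) (at t)"
    by (auto intro!: derivative_eq_intros)
  from has_derivative_compose[OF this D] show ?thesis
    unfolding has_field_derivative_def using linear_scale[OF has_derivative_linear[OF D]]
    by (simp add: fun_eq_iff mult.commute[of _ "?D v"])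
qed

text \<open>The mean value theorem is applied twice: along \<open>u\<close> to the increment of
  \<open>f\<close> under the shift by \<open>h *\<^sub>R v\<close>, then along \<open>v\<close> to
  the resulting derivative in direction \<open>u\<close>. The left side is symmetric in
  \<open>u\<close> and \<open>v\<close>, the right side is not visibly so.\<close>

lemma second_difference_mean_value:
  fixes f :: "'a::euclidean_space \<Rightarrow> real"
  assumes f: "Ck_on 2 S f" and S: "ball x e \<subseteq> S" and h: "0 < h" "h * (norm u + norm v) < e"
  shows "\<exists>z. dist x z \<le> h * (norm u + norm v) \<and>
    f (x + h *\<^sub>R u + h *\<^sub>R v) - f (x + h *\<^sub>R u) - f (x + h *\<^sub>R v) + f x =
    h * h * frechet_derivative (\<lambda>y. frechet_derivative f (at y) u) (at z) v"
proof -
  have f1: "Ck_on (Suc 0) S (\<lambda>y. frechet_derivative f (at y) u)" and f0: "\<And>y. y \<in> S \<Longrightarrow> f differentiable (at y)"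
    using f by (simp_all add: numeral_2_eq_2)
  have near: "dist x (x + s *\<^sub>R u + t *\<^sub>R v) \<le> h * (norm u + norm v)"
    if "0 \<le> s" "s \<le> h" "0 \<le> t" "t \<le> h" for s t
  proof -
    have "dist x (x + s *\<^sub>R u + t *\<^sub>R v) = norm (s *\<^sub>R u + t *\<^sub>R v)"
      using dist_norm[of "x + (s *\<^sub>R u + t *\<^sub>R v)" x] by (simp add: dist_commute[of x] add.assoc)
    also have "\<dots> \<le> s * norm u + t * norm v"
      by (rule order_trans[OF norm_triangle_ineq]) (use that in simp)
    also have "\<dots> \<le> h * norm u + h * norm v"
      using that by (intro add_mono mult_right_mono) auto
    finally show ?thesis by (simp only: distrib_left)
  qed
  have inS: "x + s *\<^sub>R u + t *\<^sub>R v \<in> S"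
    if "0 \<le> s" "s \<le> h" "0 \<le> t" "t \<le> h" for s t
    using order_le_less_trans[OF near[OF that] h(2)] S by auto
  let ?\<phi> = "\<lambda>s. f ((x + h *\<^sub>R v) + s *\<^sub>R u) - f (x + s *\<^sub>R u)"
  have "\<exists>s>0. s < h \<and> ?\<phi> h - ?\<phi> 0 = (h - 0) *
      (frechet_derivative f (at ((x + h *\<^sub>R v) + s *\<^sub>R u)) u - frechet_derivative f (at (x + s *\<^sub>R u)) u)"
  proof (rule MVT2[OF h(1)])
    fix s assume s: "0 \<le> s" "s \<le> h"
    show "(?\<phi> has_real_derivative
      frechet_derivative f (at ((x + h *\<^sub>R v) + s *\<^sub>R u)) u - frechet_derivative f (at (x + s *\<^sub>R u)) u) (at s)"
    proof (rule DERIV_diff)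
      have "x + h *\<^sub>R v + s *\<^sub>R u \<in> S" "x + s *\<^sub>R u \<in> S"
        using inS[OF s, of h] inS[OF s, of 0] h by (simp_all add: add.assoc add.commute[of "h *\<^sub>R v"])
      then show "((\<lambda>s. f ((x + h *\<^sub>R v) + s *\<^sub>R u)) has_real_derivative frechet_derivative f (at ((x + h *\<^sub>R v) + s *\<^sub>R u)) u) (at s)"
        "((\<lambda>s. f (x + s *\<^sub>R u)) has_real_derivative frechet_derivative f (at (x + s *\<^sub>R u)) u) (at s)"
        using has_real_derivative_along_line f0 by blast+
    qed
  qed
  then obtain s where s: "0 < s" "s < h" and \<Delta>: "?\<phi> h - ?\<phi> 0 = h *
      (frechet_derivative f (at ((x + h *\<^sub>R v) + s *\<^sub>R u)) u - frechet_derivative f (at (x + s *\<^sub>R u)) u)"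
    by auto
  let ?\<psi> = "\<lambda>t. frechet_derivative f (at ((x + s *\<^sub>R u) + t *\<^sub>R v)) u"
  have "\<exists>t>0. t < h \<and> ?\<psi> h - ?\<psi> 0 = (h - 0) *
      frechet_derivative (\<lambda>y. frechet_derivative f (at y) u) (at ((x + s *\<^sub>R u) + t *\<^sub>R v)) v"
  proof (rule MVT2[OF h(1)])
    fix t assume t: "0 \<le> t" "t \<le> h"
    show "(?\<psi> has_real_derivative
      frechet_derivative (\<lambda>y. frechet_derivative f (at y) u) (at ((x + s *\<^sub>R u) + t *\<^sub>R v)) v) (at t)"
      using inS[OF _ _ t, of s] s f1
      by (intro has_real_derivative_along_line[where f="\<lambda>y. frechet_derivative f (at y) u"]) simp
  qed
  then obtain t where t: "0 < t" "t < h" and \<psi>: "?\<psi> h - ?\<psi> 0 = h *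
      frechet_derivative (\<lambda>y. frechet_derivative f (at y) u) (at ((x + s *\<^sub>R u) + t *\<^sub>R v)) v"
    by auto
  show ?thesis
  proof (intro exI conjI)
    show "dist x (x + s *\<^sub>R u + t *\<^sub>R v) \<le> h * (norm u + norm v)" using near s t by simp
    show "f (x + h *\<^sub>R u + h *\<^sub>R v) - f (x + h *\<^sub>R u) - f (x + h *\<^sub>R v) + f x =
      h * h * frechet_derivative (\<lambda>y. frechet_derivative f (at y) u) (at (x + s *\<^sub>R u + t *\<^sub>R v)) v"
    proof -
      have swap: "x + a + b = x + b + a" for a b by simp
      have "f (x + h *\<^sub>R u + h *\<^sub>R v) - f (x + h *\<^sub>R u) - f (x + h *\<^sub>R v) + f x = ?\<phi> h - ?\<phi> 0"
        unfolding swap[of "h *\<^sub>R v"] scaleR_zero_left add_0_right by linarith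
      also have "\<dots> = h * (?\<psi> h - ?\<psi> 0)"
        using \<Delta> unfolding swap[of "h *\<^sub>R v"] scaleR_zero_left add_0_right .
      finally show ?thesis unfolding \<psi> mult.assoc .
    qed
  qed
qed

text \<open>Both mixed derivatives equal the same second difference divided by \<open>h * h\<close>,
  each at its own intermediate point; continuity lets these points shrink to
  \<open>x\<close>.\<close>

lemma symmetric_second_derivative:
  fixes f :: "'a::euclidean_space \<Rightarrow> real"
  assumes S: "open S" "x \<in> S" and f: "Ck_on 2 S f"
  shows "frechet_derivative (\<lambda>y. frechet_derivative f (at y) u) (at x) v =
         frechet_derivative (\<lambda>y. frechet_derivative f (at y) v) (at x) u"
proof -
  let ?A = "\<lambda>u v x. frechet_derivative (\<lambda>y. frechet_derivative f (at y) u) (at x) v"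
  obtain e where e: "e > 0" "ball x e \<subseteq> S" using S openE by blast
  have cont: "isCont (?A u v) x" for u v
    using f S by (simp add: numeral_2_eq_2 continuous_on_eq_continuous_at)
  have "\<bar>?A u v x - ?A v u x\<bar> < \<epsilon>" if eps: "\<epsilon> > 0" for \<epsilon>
  proof -
    obtain d1 where d1: "d1 > 0" "\<And>z. dist z x < d1 \<Longrightarrow> dist (?A u v z) (?A u v x) < \<epsilon> / 2"
      using cont[of u v, unfolded continuous_at_eps_delta, rule_format, OF half_gt_zero[OF eps]] by blast
    obtain d2 where d2: "d2 > 0" "\<And>z. dist z x < d2 \<Longrightarrow> dist (?A v u z) (?A v u x) < \<epsilon> / 2"
      using cont[of v u, unfolded continuous_at_eps_delta, rule_format, OF half_gt_zero[OF eps]] by blast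
    define m where "m = min e (min d1 d2)"
    \<comment> \<open>The summand 1 keeps the denominator positive even for
      \<open>u = v = 0\<close>; the factor 2 makes the step strictly smaller than
      \<open>m\<close>.\<close>
    define h where "h = m / (2 * (norm u + norm v + 1))"
    have m: "m > 0" "m \<le> e" "m \<le> d1" "m \<le> d2" using e d1 d2 by (simp_all add: m_def)
    have pos: "norm u + norm v + 1 > 0" by (smt (verit) norm_ge_zero)
    with m have h: "h > 0" by (simp add: h_def)
    have "h * (norm u + norm v + 1) = m / 2" using pos by (simp add: h_def divide_simps)
    with h m(1) have hm: "h * (norm u + norm v) < m" by (simp add: distrib_left)
    then have he: "h * (norm u + norm v) < e" "h * (norm v + norm u) < e"
      using m(2) by (simp_all add: add.commute)
    obtain z1 where z1: "dist x z1 \<le> h * (norm u + norm v)" "f (x + h *\<^sub>R u + h *\<^sub>R v) - f (x + h *\<^sub>R u) - f (x + h *\<^sub>R v) + f x = h * h * ?A u v z1"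
      using second_difference_mean_value[OF f e(2) h he(1)] by blast
    obtain z2 where z2: "dist x z2 \<le> h * (norm v + norm u)" "f (x + h *\<^sub>R v + h *\<^sub>R u) - f (x + h *\<^sub>R v) - f (x + h *\<^sub>R u) + f x = h * h * ?A v u z2"
      using second_difference_mean_value[OF f e(2) h he(2)] by blast
    have "dist z1 x < d1" "dist z2 x < d2" using z1(1) z2(1) hm m by (simp_all add: dist_commute add.commute)
    have swap: "x + h *\<^sub>R v + h *\<^sub>R u = x + h *\<^sub>R u + h *\<^sub>R v" by simp
    have "h * h * ?A u v z1 = h * h * ?A v u z2"
      using z1(2) z2(2)[unfolded swap] by linarith
    then have "?A u v z1 = ?A v u z2" using h by simp
    moreover have "dist (?A u v z1) (?A u v x) < \<epsilon> / 2" "dist (?A v u z2) (?A v u x) < \<epsilon> / 2"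
      using d1(2) d2(2) \<open>dist z1 x < d1\<close> \<open>dist z2 x < d2\<close> by blast+
    ultimately show ?thesis unfolding dist_real_def by linarith
  qed
  then have "\<not> 0 < \<bar>?A u v x - ?A v u x\<bar>" by blast
  then show ?thesis by simp
qed

section \<open>Inverse function theorem in the plane, with an inverse of class C^r\<close>

lemma cramer_plane:
  fixes a b c d e s t :: real
  assumes d: "d = a * e - c * b" "d \<noteq> 0"
  shows "(s * a + t * c) * (e / d) - (s * b + t * e) * (c / d) = s"
    and "(s * b + t * e) * (a / d) - (s * a + t * c) * (b / d) = t"
proof -
  have "(s * a + t * c) * (e / d) - (s * b + t * e) * (c / d) = s * d / d"
    unfolding times_divide_eq_right diff_divide_distrib[symmetric] d(1)
    by (rule arg_cong[where f="\<lambda>x. x / _"]) algebra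
  then show "(s * a + t * c) * (e / d) - (s * b + t * e) * (c / d) = s" using d(2) by simp
  have "(s * b + t * e) * (a / d) - (s * a + t * c) * (b / d) = t * d / d"
    unfolding times_divide_eq_right diff_divide_distrib[symmetric] d(1)
    by (rule arg_cong[where f="\<lambda>x. x / _"]) algebra
  then show "(s * b + t * e) * (a / d) - (s * a + t * c) * (b / d) = t" using d(2) by simp
qed

definition jacobian_det :: "(real \<times> real \<Rightarrow> real \<times> real) \<Rightarrow> real \<times> real \<Rightarrow> real" where
  "jacobian_det f a = (let u = frechet_derivative f (at a) (1, 0); v = frechet_derivative f (at a) (0, 1)
     in fst u * snd v - fst v * snd u)"

text \<open>The inverse function theorem gives a homeomorphism near \<open>a\<close>. For its class,
  \<open>M\<close> writes the inverse of the derivative by Cramer's rule: its entries are quotients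
  of first derivatives of \<open>f\<close>, hence of class one less than \<open>f\<close>, which is
  the input of \<open>Ck_on_inverse_map\<close>.\<close>

lemma Cr_local_inverse_plane:
  fixes f :: "real \<times> real \<Rightarrow> real \<times> real"
  assumes r: "1 \<le> r" and S: "open S" "a \<in> S" and f: "Cr_on r S f" and det: "jacobian_det f a \<noteq> 0"
  obtains U V g where "open U" "a \<in> U" "U \<subseteq> S" "open V" "homeomorphism U V f g" "Cr_on r V g"
proof -
  let ?D = "\<lambda>x. frechet_derivative f (at x)"
  have f1: "Ck_on (Suc 0) S f" using f r unfolding Cr_on_def by (metis One_nat_def one_enat_def)
  have D: "(f has_derivative ?D x) (at x)" if "x \<in> S" for x using Ck_on_SucE[OF f1 that] .
  have bl: "bounded_linear (?D x)" if "x \<in> S" for x using D[OF that] has_derivative_bounded_linear by blast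
  have Dexp: "?D x (s, t) = s *\<^sub>R ?D x (1, 0) + t *\<^sub>R ?D x (0, 1)" if "x \<in> S" for x s t
  proof -
    have "linear (?D x)" using bl[OF that] bounded_linear.linear by blast
    from linear_add[OF this, of "s *\<^sub>R (1,0)" "t *\<^sub>R (0,1)"] linear_scale[OF this, of s "(1,0)"]
      linear_scale[OF this, of t "(0,1)"]
    show ?thesis by simp
  qed
  define M where "M x v = (let u = ?D x (1, 0); w = ?D x (0, 1); d = jacobian_det f x in
    (fst v * (snd w / d) - snd v * (fst w / d), snd v * (fst u / d) - fst v * (snd u / d)))" for x v
  have contD: "continuous_on S (\<lambda>x. ?D x v)" for v using f1 by (cases v) simp
  have contdet: "continuous_on S (jacobian_det f)"
    unfolding jacobian_det_def Let_def by (intro continuous_intros contD)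
  \<comment> \<open>Nonvanishing of the determinant is assumed at \<open>a\<close> only and spreads
    to an open set by continuity.\<close>
  define S' where "S' = {x \<in> S. jacobian_det f x \<noteq> 0}"
  have S': "open S'" "a \<in> S'" "S' \<subseteq> S"
    using continuous_open_preimage[OF contdet S(1), of "- {0}"] S(2) det
    by (auto simp: S'_def Int_def vimage_def)
  have blM: "bounded_linear (M x)" for x
    unfolding M_def Let_def
    by (intro bounded_linear_Pair bounded_linear_sub bounded_linear_mult_const bounded_linear_fst bounded_linear_snd)
  have MD: "M x (?D x v) = v" if "x \<in> S'" for x v
  proof -
    obtain s t where v: "v = (s, t)" by fastforce
    have x: "x \<in> S" "jacobian_det f x \<noteq> 0" using that by (auto simp: S'_def)
    have det: "jacobian_det f x = fst (?D x (1, 0)) * snd (?D x (0, 1)) - fst (?D x (0, 1)) * snd (?D x (1, 0))"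
      by (simp add: jacobian_det_def Let_def)
    have "M x (?D x v) = (s, t)"
      unfolding v M_def Let_def Dexp[OF x(1), of s t] prod.inject fst_add snd_add fst_scaleR snd_scaleR real_scaleR_def
      using cramer_plane[OF det x(2), of s t] by simp
    then show ?thesis using v by simp
  qed
  have "continuous_on S (\<lambda>x. Blinfun (?D x))"
  proof (rule continuous_on_blinfun_componentwise)
    show "continuous_on S (\<lambda>x. Blinfun (?D x) v)" for v
      using contD[of v] by (rule continuous_on_eq) (simp add: bounded_linear_Blinfun_apply[OF bl])
  qed
  moreover have "Blinfun (M a) o\<^sub>L Blinfun (?D a) = id_blinfun"
    using MD[OF S'(2)] by (intro blinfun_eqI) (simp add: bounded_linear_Blinfun_apply[OF blM] bounded_linear_Blinfun_apply[OF bl[OF S(2)]])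
  ultimately obtain U V g where U: "open U" "U \<subseteq> S'" "a \<in> U" "open V" "homeomorphism U V f g"
  proof (rule inverse_function_theorem[OF S'(1) _ continuous_on_subset[OF _ S'(3)] S'(2), rotated])
    show "(f has_derivative blinfun_apply (Blinfun (?D x))) (at x)" if "x \<in> S'" for x
      using D[of x] bl[of x] that S'(3) by (auto simp: bounded_linear_Blinfun_apply)
  qed (erule that)
  have "Cr_on r V g"
  proof (rule Cr_onI[OF _ r])
    fix k assume "enat (Suc k) \<le> r"
    then have fk: "Ck_on (Suc k) S' f" using f S'(3) Ck_on_subset unfolding Cr_on_def by blast
    show "Ck_on (Suc k) V g"
    proof (rule Ck_on_inverse_map[where S=S' and f=f and f'="?D" and M=M])
      show "g ` V \<subseteq> S'" "continuous_on V g" "\<And>y. y \<in> V \<Longrightarrow> f (g y) = y"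
        using U by (auto simp: homeomorphism_def)
      have kD: "Ck_on k S' (\<lambda>x. ?D x v)" for v using fk by (cases v) simp
      have kdet: "Ck_on k S' (jacobian_det f)" unfolding jacobian_det_def[abs_def] Let_def
        by (intro Ck_on_diff Ck_on_mult S' Ck_on_fst Ck_on_snd kD)
      show "Ck_on k S' (\<lambda>x. M x v)" for v
        unfolding M_def Let_def
        by (intro Ck_on_Pair Ck_on_divide Ck_on_diff Ck_on_mult Ck_on_const S' Ck_on_fst Ck_on_snd kD kdet)
          (simp_all add: S'_def)
    qed (use S' U blM MD D in auto)
  qed
  with U S' that show ?thesis by blast
qed

section \<open>Inverses and charts\<close>

text \<open>The inverse is global because \<open>I\<close> is an interval: two equal values would
  force a zero of the derivative in between. Invariance of domain then gives the open image and the
  continuous inverse.\<close>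

lemma Cr_inverse_real:
  fixes X :: "real \<Rightarrow> real"
  assumes r: "1 \<le> r" and I: "open I" "is_interval I" and X: "Cr_on r I X" and X': "\<And>x. x \<in> I \<Longrightarrow> deriv X x \<noteq> 0"
  shows "inj_on X I" "open (X ` I)" "homeomorphism I (X ` I) X (the_inv_into I X)" "Cr_on r (X ` I) (the_inv_into I X)"
proof -
  have X1: "Ck_on (Suc 0) I X" using X r unfolding Cr_on_def by (metis One_nat_def one_enat_def)
  have DX: "(X has_real_derivative deriv X x) (at x)" if "x \<in> I" for x
    using X1 that by (simp add: DERIV_deriv_iff_real_differentiable)
  have frD: "frechet_derivative X (at x) = (\<lambda>v. deriv X x * v)" if "x \<in> I" for x
    using frechet_derivative_at[OF DX[OF that, unfolded has_field_derivative_def]] by simp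
  have cX: "continuous_on I X" using X Cr_on_continuous_on by blast
  show inj: "inj_on X I"
  proof (rule linorder_inj_onI')
    fix a b assume ab: "a \<in> I" "b \<in> I" "a < b"
    then have sub: "{a..b} \<subseteq> I" using I(2) unfolding is_interval_1 by (meson atLeastAtMost_iff subsetI)
    show "X a \<noteq> X b"
    proof
      assume eq: "X a = X b"
      have "\<exists>z>a. z < b \<and> X b - X a = (b - a) * deriv X z"
      proof (rule MVT2[OF ab(3)])
      show "(X has_real_derivative deriv X x) (at x)" if "a \<le> x" "x \<le> b" for x
        using DX[of x] sub that by (simp add: subset_iff)
    qed
      then obtain z where "a < z" "z < b" "deriv X z = 0" using eq ab by auto
      then show False using X' sub by (metis atLeastAtMost_iff less_imp_le subsetD)
    qed
  qed
  show op: "open (X ` I)" using invariance_of_domain[OF cX I(1) inj] .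
  obtain g where g: "homeomorphism I (X ` I) X g"
    using invariance_of_domain_homeomorphism[OF I(1) cX _ inj] by auto
  have "the_inv_into I X y = g y" if "y \<in> X ` I" for y
    using g that the_inv_into_f_f[OF inj] by (auto simp: homeomorphism_def)
  then show hom: "homeomorphism I (X ` I) X (the_inv_into I X)"
    by (intro homeomorphism_cong[OF g]) auto
  show "Cr_on r (X ` I) (the_inv_into I X)"
  proof (rule Cr_onI[OF _ r])
    fix k assume "enat (Suc k) \<le> r"
    then have Xk: "Ck_on (Suc k) I X" using X unfolding Cr_on_def by blast
    show "Ck_on (Suc k) (X ` I) (the_inv_into I X)"
    proof (rule Ck_on_inverse_map[where S=I and f=X and f'="\<lambda>x v. deriv X x * v" and M="\<lambda>x v. v / deriv X x"])
      have "Ck_on k I (\<lambda>x. frechet_derivative X (at x) 1)" using Xk by simp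
      then have "Ck_on k I (deriv X)" by (rule Ck_on_cong[OF I(1), rotated]) (simp add: frD)
      then show "Ck_on k I (\<lambda>x. v / deriv X x)" for v
        by (intro Ck_on_divide Ck_on_const I X')
      show "bounded_linear (\<lambda>v. v / deriv X x)" for x by (rule bounded_linear_divide)
      show "the_inv_into I X ` X ` I \<subseteq> I" "continuous_on (X ` I) (the_inv_into I X)"
        using hom unfolding homeomorphism_def by simp_all
      show "X (the_inv_into I X y) = y" if "y \<in> X ` I" for y
        using hom that unfolding homeomorphism_def by blast
      show "(X has_derivative (\<lambda>v. deriv X x * v)) (at x)" if "x \<in> I" for x
        using DX[OF that] unfolding has_field_derivative_def .
    qed (simp_all add: I op X')
  qed
qed

section \<open>Charts and admissible changes of coordinates\<close>

lemma chart_image_open: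
  assumes "is_chart (U, \<phi>)" "open O'" "O' \<subseteq> U"
  shows "open (\<phi> ` O')"
proof -
  have U: "open U" "open (\<phi> ` U)" "homeomorphism U (\<phi> ` U) \<phi> (the_inv_into U \<phi>)"
    using assms(1) by (auto simp: is_chart_def)
  have "openin (top_of_set U) O'" using assms U by (simp add: openin_open_eq)
  then have "openin (top_of_set (\<phi> ` U)) (\<phi> ` O')" using homeomorphism_imp_open_map[OF U(3)] by blast
  then show ?thesis using U(2) by (simp add: openin_open_eq)
qed

text \<open>Both transitions with a chart of the atlas factor through \<open>\<phi>\<close>: one is
  an old transition after \<open>G\<close>, the other is \<open>X\<close> after an old transition.
  This makes the new coordinates on both manifolds admissible.\<close>

lemma local_coords_reparametrize:
  fixes A :: "('m::{t2_space,second_countable_topology}, 'e::euclidean_space) chart set"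
  assumes A: "Cr_atlas r A" "(U0, \<phi>) \<in> A" and U: "open U" "U \<subseteq> U0"
    and X: "homeomorphism (\<phi> ` U) W X G" "open W" "Cr_on r (\<phi> ` U) X" "Cr_on r W G"
  shows "local_coords r A (U, X \<circ> \<phi>)"
proof -
  define e where "e = the_inv_into U0 \<phi>"
  define e' where "e' = the_inv_into U (X \<circ> \<phi>)"
  have ch: "is_chart (U0, \<phi>)" using A by (auto simp: Cr_atlas_def)
  then have U0: "open U0" "inj_on \<phi> U0" "homeomorphism U0 (\<phi> ` U0) \<phi> e"
    by (auto simp: is_chart_def e_def)
  have opU: "open (\<phi> ` U)" using chart_image_open[OF ch U] .
  have XU: "X ` \<phi> ` U = W" and GX: "\<And>z. z \<in> \<phi> ` U \<Longrightarrow> G (X z) = z" and XG: "\<And>w. w \<in> W \<Longrightarrow> X (G w) = w"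
    and GW: "G ` W = \<phi> ` U" and cG: "continuous_on W G"
    using X(1) by (auto simp: homeomorphism_def)
  have im: "(X \<circ> \<phi>) ` U = W" using XU by (simp add: image_comp)
  have e: "e (\<phi> m) = m" if "m \<in> U0" for m using U0 that by (simp add: homeomorphism_def)
  have inj: "inj_on (X \<circ> \<phi>) U"
    using GX U e by (intro inj_on_inverseI[where g="e \<circ> G"]) auto
  have e'eq: "e' w = e (G w)" if wW: "w \<in> W" for w
  proof -
    obtain m where m: "m \<in> U" "w = X (\<phi> m)" using wW unfolding im[symmetric] by auto
    then have "e' w = m" using the_inv_into_f_f[OF inj] by (simp add: e'_def)
    then show ?thesis using m GX e U by auto
  qed
  have homU: "homeomorphism U (\<phi> ` U) \<phi> e"
    by (rule homeomorphism_of_subsets[OF U0(3) U(2) subset_refl refl])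
  have hom: "homeomorphism U W (X \<circ> \<phi>) (e \<circ> G)"
    by (rule homeomorphism_compose[OF homU X(1)])
  then have hom': "homeomorphism U W (X \<circ> \<phi>) e'"
    by (rule homeomorphism_cong) (auto simp: e'eq)
  have chart: "is_chart (U, X \<circ> \<phi>)"
    using U im inj X(2) hom' unfolding is_chart_def e'_def by auto
  show ?thesis unfolding local_coords_def
  proof (intro conjI ballI chart)
    fix d assume dA: "d \<in> A"
    obtain V \<psi> where d: "d = (V, \<psi>)" by fastforce
    have chd: "is_chart (V, \<psi>)" using A dA d by (auto simp: Cr_atlas_def)
    then have V: "open V" "inj_on \<psi> V" by (auto simp: is_chart_def)
    have comp: "Cr_compatible r (U0, \<phi>) (V, \<psi>)" using A dA d by (auto simp: Cr_atlas_def)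
    then have t1: "Cr_on r (\<phi> ` (U0 \<inter> V)) (\<psi> \<circ> e)" and t2: "Cr_on r (\<psi> ` (V \<inter> U0)) (\<phi> \<circ> the_inv_into V \<psi>)"
      by (auto simp: Cr_compatible_def Cr_transition_def e_def)
    have o1: "open (\<phi> ` (U \<inter> V))" using chart_image_open[OF ch] U V by (simp add: le_infI1 open_Int)
    have o1': "open (\<phi> ` (U0 \<inter> V))" using chart_image_open[OF ch] U0 V by (simp add: open_Int)
    have o2: "open (\<psi> ` (V \<inter> U))" using chart_image_open[OF chd] U V by (simp add: open_Int)
    have o3: "open ((X \<circ> \<phi>) ` (U \<inter> V))"
      by (rule chart_image_open[OF chart]) (use U V in auto)
    have sub3: "(X \<circ> \<phi>) ` (U \<inter> V) \<subseteq> W" using im by auto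
    have "Cr_on r ((X \<circ> \<phi>) ` (U \<inter> V)) (\<lambda>w. (\<psi> \<circ> e) (G w))"
    proof (rule Cr_on_compose[OF o3 o1' _ t1 Cr_on_subset[OF X(4) sub3]])
      show "G ` (X \<circ> \<phi>) ` (U \<inter> V) \<subseteq> \<phi> ` (U0 \<inter> V)" using GX U by auto
    qed
    then have "Cr_on r ((X \<circ> \<phi>) ` (U \<inter> V)) (\<psi> \<circ> e')"
      by (rule Cr_on_cong[OF o3, rotated]) (use sub3 e'eq in auto)
    moreover
    have inv: "the_inv_into V \<psi> (\<psi> m) = m" if "m \<in> V" for m using V that by (simp add: the_inv_into_f_f)
    have "Cr_on r (\<psi> ` (V \<inter> U)) (\<lambda>z. X ((\<phi> \<circ> the_inv_into V \<psi>) z))"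
      by (rule Cr_on_compose[OF o2 opU _ X(3) Cr_on_subset[OF t2]]) (use U inv in auto)
    ultimately show "Cr_compatible r (U, X \<circ> \<phi>) d"
      by (simp add: d Cr_compatible_def Cr_transition_def e'_def comp_def)
  qed
qed

section \<open>Linear equations and Wronskians\<close>

text \<open>Integrating factor: \<open>u x * exp (- E x)\<close> has derivative zero, so one zero of
  \<open>u\<close> forces all others.\<close>

lemma linear_ode_zero:
  fixes u g :: "real \<Rightarrow> real"
  assumes g: "continuous_on {a..b} g"
    and u: "\<And>x. x \<in> {a..b} \<Longrightarrow> (u has_real_derivative g x * u x) (at x within {a..b})"
    and z: "z \<in> {a..b}" "u z = 0" and x: "x \<in> {a..b}"
  shows "u x = 0"
proof -
  define E where "E x = integral {a..x} g" for x
  have E: "(E has_real_derivative g x) (at x within {a..b})" if "x \<in> {a..b}" for x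
    unfolding E_def[abs_def] using integral_has_real_derivative[OF g that] .
  have "((\<lambda>x. u x * exp (- E x)) has_real_derivative 0) (at x within {a..b})" if "x \<in> {a..b}" for x
    by (rule derivative_eq_intros u[OF that] E[OF that] refl)+ (simp add: algebra_simps)
  then have "\<exists>c. \<forall>x\<in>{a..b}. u x * exp (- E x) = c"
    by (intro has_field_derivative_zero_constant) auto
  then have "u x * exp (- E x) = u z * exp (- E z)" using x z by force
  then show ?thesis using z by simp
qed

text \<open>Dividing by \<open>D\<close>, which is nonzero near \<open>z\<close>, turns
  \<open>W\<close> into the linear equation (C/D)' = - (\<kappa>/D) (C/D). The quotient vanishes at
  \<open>z\<close>, hence on a whole interval.\<close>

lemma wronskian_zero_not_isolated:
  fixes C D C' D' :: "real \<Rightarrow> real"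
  assumes I: "open I" and z: "z \<in> I" "C z = 0" "D z \<noteq> 0"
    and C: "\<And>x. x \<in> I \<Longrightarrow> (C has_real_derivative C' x) (at x)"
    and D: "\<And>x. x \<in> I \<Longrightarrow> (D has_real_derivative D' x) (at x)"
    and W: "\<And>x. x \<in> I \<Longrightarrow> C x * D' x - D x * C' x = \<kappa> * C x"
  shows "\<exists>y\<in>I. y \<noteq> z \<and> C y = 0"
proof -
  have cD: "continuous_on I D" using D DERIV_continuous_on I at_within_open by metis
  have "open {x \<in> I. D x \<noteq> 0}"
    using continuous_open_preimage[OF cD I, of "- {0}"] by (auto simp: Int_def vimage_def)
  then obtain e where e: "e > 0" "cball z e \<subseteq> {x \<in> I. D x \<noteq> 0}"
    using z open_contains_cball by (metis (mono_tags, lifting) mem_Collect_eq)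
  have sub: "x \<in> I" "D x \<noteq> 0" if "x \<in> {z - e..z + e}" for x
    using e(2) that by (auto simp: cball_eq_atLeastAtMost)
  have "C (z + e) / D (z + e) = 0"
  proof (rule linear_ode_zero[where u="\<lambda>x. C x / D x" and a="z - e" and b="z + e" and g="\<lambda>x. - \<kappa> / D x" and z=z])
    show "continuous_on {z - e..z + e} (\<lambda>x. - \<kappa> / D x)"
      using sub by (intro continuous_intros continuous_on_subset[OF cD]) auto
    fix x assume x: "x \<in> {z - e..z + e}"
    have "((\<lambda>x. C x / D x) has_real_derivative (C' x * D x - C x * D' x) / (D x * D x)) (at x)"
      using DERIV_divide[OF C D] sub[OF x] by blast
    moreover have "(C' x * D x - C x * D' x) / (D x * D x) = - \<kappa> / D x * (C x / D x)"
      using W[OF sub(1)[OF x]] sub(2)[OF x] by (simp add: field_simps)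
    ultimately show "((\<lambda>x. C x / D x) has_real_derivative - \<kappa> / D x * (C x / D x)) (at x within {z - e..z + e})"
      using has_field_derivative_at_within by metis
  qed (use z e in auto)
  then have "C (z + e) = 0" using sub(2)[of "z + e"] e by auto
  then show ?thesis using sub(1)[of "z + e"] e by (intro bexI[of _ "z + e"]) auto
qed

text \<open>Put C = c1 l + c2 m and D = d1 l + d2 m. Their Wronskian is (c1 d2 - c2 d1)(l m' - m l')
  = C, so (D/C)' = C/C^2 = 1/C. What needs proof is that C has no zero, and that \<open>c1\<close>,
  \<open>c2\<close> are not both 0.\<close>

lemma affine_coordinate:
  fixes l m l' m' :: "real \<Rightarrow> real"
  assumes I: "open I" "I \<noteq> {}"
    and l: "\<And>x. x \<in> I \<Longrightarrow> (l has_real_derivative l' x) (at x)"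
    and m: "\<And>x. x \<in> I \<Longrightarrow> (m has_real_derivative m' x) (at x)"
    and W: "\<And>x. x \<in> I \<Longrightarrow> l x * m' x - m x * l' x = c1 * l x + c2 * m x"
    and det: "\<And>x y. x \<in> I \<Longrightarrow> y \<in> I \<Longrightarrow> x \<noteq> y \<Longrightarrow> l x * m y - m x * l y \<noteq> 0"
  obtains d1 d2 where "c1 * d2 - c2 * d1 = 1"
    "\<And>x. x \<in> I \<Longrightarrow> c1 * l x + c2 * m x \<noteq> 0"
    "\<And>x. x \<in> I \<Longrightarrow> ((\<lambda>x. (d1 * l x + d2 * m x) / (c1 * l x + c2 * m x)) has_real_derivative
        1 / (c1 * l x + c2 * m x)) (at x)"
proof -
  have D: "((\<lambda>x. a * l x + b * m x) has_real_derivative a * l' x + b * m' x) (at x)" if "x \<in> I" for a b x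
    by (rule derivative_eq_intros l[OF that] m[OF that] refl)+ simp
  \<comment> \<open>Stated for a general combination with weights \<open>a1\<close>,
    \<open>a2\<close> because it serves twice: with \<open>\<kappa> = 1\<close> for C itself, and
    with \<open>\<kappa> = 0\<close> to exclude \<open>c1 = c2 = 0\<close>.\<close>
  have no_zero: False
    if z: "z \<in> I" "a1 * l z + a2 * m z = 0" and ab: "a1 * b2 - a2 * b1 \<noteq> 0"
      and \<kappa>: "\<And>x. x \<in> I \<Longrightarrow> (a1 * b2 - a2 * b1) * (c1 * l x + c2 * m x) = \<kappa> * (a1 * l x + a2 * m x)"
    for z a1 a2 b1 b2 \<kappa>
  proof -
    \<comment> \<open>Two vectors \<open>(l x, m x)\<close> and \<open>(l y, m y)\<close>
      annihilated by the same nonzero covector \<open>(a1, a2)\<close> are parallel.\<close>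
    have kernel: "l x * m y - m x * l y = 0" if "a1 * l x + a2 * m x = 0" "a1 * l y + a2 * m y = 0" for x y
    proof -
      have "a1 * (l x * m y - m x * l y) = 0" "a2 * (l x * m y - m x * l y) = 0"
        using that by algebra+
      then show ?thesis using ab by auto
    qed
    have "b1 * l z + b2 * m z \<noteq> 0"
    proof
      assume 0: "b1 * l z + b2 * m z = 0"
      have "(a1 * b2 - a2 * b1) * l z = 0" "(a1 * b2 - a2 * b1) * m z = 0" using 0 z(2) by algebra+
      then have lm: "l z = 0" "m z = 0" using ab by auto
      obtain e where "e > 0" "cball z e \<subseteq> I" using I(1) z(1) open_contains_cball by blast
      then have "z + e \<in> I" "z + e \<noteq> z" by (auto simp: subset_iff dist_real_def)
      then show False using det[OF z(1), of "z + e"] lm by auto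
    qed
    moreover have "(a1 * l x + a2 * m x) * (b1 * l' x + b2 * m' x) - (b1 * l x + b2 * m x) * (a1 * l' x + a2 * m' x) = \<kappa> * (a1 * l x + a2 * m x)"
      if "x \<in> I" for x
    proof -
      have "(a1 * l x + a2 * m x) * (b1 * l' x + b2 * m' x) - (b1 * l x + b2 * m x) * (a1 * l' x + a2 * m' x)
        = (a1 * b2 - a2 * b1) * (l x * m' x - m x * l' x)" by algebra
      then show ?thesis using W[OF that] \<kappa>[OF that] by simp
    qed
    ultimately obtain y where y: "y \<in> I" "y \<noteq> z" "a1 * l y + a2 * m y = 0"
      using wronskian_zero_not_isolated[OF I(1) z(1,2) _ D D] by blast
    then show False using det[OF y(1) z(1)] kernel[OF y(3) z(2)] by blast
  qed
  have c: "c1 \<noteq> 0 \<or> c2 \<noteq> 0"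
  proof (rule ccontr)
    assume "\<not> ?thesis"
    then have c0: "c1 = 0" "c2 = 0" by auto
    obtain z where z: "z \<in> I" using I(2) by blast
    obtain e where "e > 0" "cball z e \<subseteq> I" using I(1) z(1) open_contains_cball by blast
    then have "z + e \<in> I" "z + e \<noteq> z" by (auto simp: subset_iff dist_real_def)
    then have "l z \<noteq> 0 \<or> m z \<noteq> 0" using det[OF z, of "z + e"] by auto
    then have "m z * m z + l z * l z \<noteq> 0" by (auto simp: sum_squares_eq_zero_iff)
    \<comment> \<open>The covector \<open>(m z, - l z)\<close> annihilates
      \<open>(l z, m z)\<close>, so any point \<open>z\<close> yields a zero; with
      \<open>(l z, m z)\<close> as second row the determinant is a sum of two squares.\<close>
    then show False using no_zero[OF z, where ?a1.0="m z" and ?a2.0="- l z" and ?b1.0="l z" and ?b2.0="m z" and \<kappa>=0] c0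
      by (simp add: mult.commute)
  qed
  \<comment> \<open>\<open>(d1, d2)\<close> is \<open>(c1, c2)\<close> turned by a right angle and
    divided by its squared length, which normalises the determinant to 1.\<close>
  define n where "n = c1 * c1 + c2 * c2"
  have n: "n \<noteq> 0" using c unfolding n_def by (simp add: sum_squares_eq_zero_iff)
  define d1 where "d1 = - c2 / n"
  define d2 where "d2 = c1 / n"
  have cd: "c1 * d2 - c2 * d1 = 1"
  proof -
    have "c1 * d2 - c2 * d1 = (c1 * c1 + c2 * c2) / n"
      unfolding d1_def d2_def by (simp add: add_divide_distrib)
    then show ?thesis using n by (simp add: n_def)
  qed
  have nz: "c1 * l x + c2 * m x \<noteq> 0" if "x \<in> I" for x
    using no_zero[OF that, of c1 c2 d2 d1 1] cd by auto
  have "((\<lambda>x. (d1 * l x + d2 * m x) / (c1 * l x + c2 * m x)) has_real_derivative 1 / (c1 * l x + c2 * m x)) (at x)"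
    if "x \<in> I" for x
  proof -
    have "(d1 * l' x + d2 * m' x) * (c1 * l x + c2 * m x) - (d1 * l x + d2 * m x) * (c1 * l' x + c2 * m' x)
      = (c1 * d2 - c2 * d1) * (l x * m' x - m x * l' x)" by algebra
    also have "\<dots> = c1 * l x + c2 * m x" using cd W[OF that] by simp
    finally show ?thesis
      using DERIV_divide[OF D[OF that, of d1 d2] D[OF that, of c1 c2] nz[OF that]] nz[OF that] by simp
  qed
  with that[OF cd nz] show thesis by blast
qed

section \<open>Affine characteristics\<close>

text \<open>The characteristics of the equation solve a linear equation along each segment issuing from
  \<open>a0\<close>, so the flow along a segment is affine in \<open>y\<close>.\<close>

lemma affine_characteristics:
  fixes F :: "real \<times> 'a::euclidean_space \<Rightarrow> real" and e0 e1 :: "'a \<Rightarrow> 'a \<Rightarrow> real"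
  assumes B: "convex B" "a0 \<in> B" and \<rho>: "\<rho> > 0"
    and F: "\<And>y a. \<bar>y\<bar> < \<rho> \<Longrightarrow> a \<in> B \<Longrightarrow> F differentiable (at (y, a))"
    and pde: "\<And>y a v. \<bar>y\<bar> < \<rho> \<Longrightarrow> a \<in> B \<Longrightarrow> frechet_derivative F (at (y, a)) (0, v) =
        frechet_derivative F (at (y, a)) (1, 0) * (e0 a v + y * e1 a v)"
    and cont: "\<And>v. continuous_on B (\<lambda>a. e0 a v)" "\<And>v. continuous_on B (\<lambda>a. e1 a v)"
    and bd: "\<And>a v. a \<in> B \<Longrightarrow> \<bar>e0 a v\<bar> \<le> M * norm v" "\<And>a v. a \<in> B \<Longrightarrow> \<bar>e1 a v\<bar> \<le> M * norm v"
  obtains \<delta> where "\<delta> > 0"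
    "\<And>a. a \<in> B \<Longrightarrow> dist a0 a < \<delta> \<Longrightarrow>
      \<exists>\<xi> \<eta>. \<forall>y. \<bar>y\<bar> < \<rho> / 8 \<longrightarrow> \<bar>\<xi> * y + \<eta>\<bar> < \<rho> \<and> F (y, a) = F (\<xi> * y + \<eta>, a0)"
proof -
  \<comment> \<open>The bound \<open>ln 2\<close> keeps the factor \<xi> between 1/2 and 2. With it,
    \<open>\<bar>y\<bar> < \<rho> / 8\<close> and \<open>\<epsilon> \<le> \<rho> / 16\<close> give
    \<open>\<bar>Y \<tau>\<bar> \<le> 2 * (2 * \<bar>y\<bar> + 4 * \<epsilon>) < \<rho>\<close>, so
    no characteristic leaves the domain of the equation.\<close>
  define \<epsilon> where "\<epsilon> = min (ln 2) (\<rho> / 16)"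
  have \<epsilon>: "\<epsilon> > 0" "\<epsilon> \<le> ln 2" "\<epsilon> \<le> \<rho> / 16" using \<rho> by (auto simp: \<epsilon>_def)
  define \<delta> where "\<delta> = \<epsilon> / (\<bar>M\<bar> + 1)"
  have \<delta>: "\<delta> > 0" using \<epsilon> by (simp add: \<delta>_def add_nonneg_pos)
  have "\<exists>\<xi> \<eta>. \<forall>y. \<bar>y\<bar> < \<rho> / 8 \<longrightarrow> \<bar>\<xi> * y + \<eta>\<bar> < \<rho> \<and> F (y, a) = F (\<xi> * y + \<eta>, a0)"
    if a: "a \<in> B" "dist a0 a < \<delta>" for a
  proof -
    define w where "w = a - a0"
    have seg: "a0 + \<tau> *\<^sub>R w \<in> B" if "\<tau> \<in> {0..1}" for \<tau>
    proof -
      have "a0 + \<tau> *\<^sub>R w = (1 - \<tau>) *\<^sub>R a0 + \<tau> *\<^sub>R a" by (simp add: w_def algebra_simps)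
      then show ?thesis using convexD[OF B(1,2) a(1), of "1 - \<tau>" \<tau>] that by simp
    qed
    have Mw: "M * norm w \<le> \<epsilon>"
    proof -
      have "norm w < \<delta>" using a(2) by (simp add: w_def dist_norm norm_minus_commute)
      then have "(\<bar>M\<bar> + 1) * norm w \<le> (\<bar>M\<bar> + 1) * \<delta>" by (intro mult_left_mono) auto
      also have "\<dots> = \<epsilon>" unfolding \<delta>_def by (simp add: add_nonneg_eq_0_iff)
      finally have "(\<bar>M\<bar> + 1) * norm w \<le> \<epsilon>" .
      moreover have "M * norm w \<le> (\<bar>M\<bar> + 1) * norm w" by (intro mult_right_mono) auto
      ultimately show ?thesis by linarith
    qed
    define b0 where "b0 \<tau> = e0 (a0 + \<tau> *\<^sub>R w) w" for \<tau>
    define b1 where "b1 \<tau> = e1 (a0 + \<tau> *\<^sub>R w) w" for \<tau>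
    have cb: "continuous_on {0..1} b0" "continuous_on {0..1} b1"
      unfolding b0_def b1_def
      by (rule continuous_on_compose2[OF cont(1)] continuous_on_compose2[OF cont(2)],
          intro continuous_intros, use seg in auto)+
    have bb: "\<bar>b0 \<tau>\<bar> \<le> \<epsilon>" "\<bar>b1 \<tau>\<bar> \<le> \<epsilon>" if "\<tau> \<in> {0..1}" for \<tau>
      using bd[OF seg[OF that], of w] Mw unfolding b0_def b1_def by linarith+
    define P where "P \<tau> = integral {0..\<tau>} b1" for \<tau>
    have P': "(P has_real_derivative b1 \<tau>) (at \<tau> within {0..1})" if "\<tau> \<in> {0..1}" for \<tau>
      unfolding P_def[abs_def] using integral_has_real_derivative[OF cb(2) that] .
    have Pb: "\<bar>P \<tau>\<bar> \<le> \<epsilon>" if "\<tau> \<in> {0..1}" for \<tau>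
    proof -
      have "norm (P \<tau>) \<le> \<epsilon> * (\<tau> - 0)"
        unfolding P_def using that bb(2)
        by (intro integral_bound continuous_on_subset[OF cb(2)]) auto
      also have "\<dots> \<le> \<epsilon>" using that \<epsilon> by simp
      finally show ?thesis by simp
    qed
    \<comment> \<open>\<open>\<xi>\<close> is the integrating factor of the linear equation Y' = -
      (b0 + b1 Y), and \<open>\<eta>\<close> is chosen so that
      \<open>\<xi> \<tau> * Y \<tau> + \<eta> \<tau>\<close> is conserved along its
      solutions.\<close>
    define \<xi> where "\<xi> \<tau> = exp (P \<tau>)" for \<tau>
    have \<xi>b: "\<xi> \<tau> \<le> 2" "1 / 2 \<le> \<xi> \<tau>" if "\<tau> \<in> {0..1}" for \<tau>
    proof -
      have "P \<tau> \<le> ln 2" "- ln 2 \<le> P \<tau>" using Pb[OF that] \<epsilon> by linarith+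
      then have "\<xi> \<tau> \<le> exp (ln 2)" "exp (- ln 2) \<le> \<xi> \<tau>"
        unfolding \<xi>_def exp_le_cancel_iff .
      moreover have "exp (ln 2) = (2::real)" "exp (- ln 2) = (1 / 2 :: real)" by (simp_all add: exp_minus)
      ultimately show "\<xi> \<tau> \<le> 2" "1 / 2 \<le> \<xi> \<tau>" by linarith+
    qed
    have \<xi>': "(\<xi> has_real_derivative \<xi> \<tau> * b1 \<tau>) (at \<tau> within {0..1})" if "\<tau> \<in> {0..1}" for \<tau>
      unfolding \<xi>_def[abs_def] by (rule DERIV_chain2[OF DERIV_exp P'[OF that]])
    have c\<xi>: "continuous_on {0..1} \<xi>" by (rule DERIV_continuous_on[OF \<xi>'])
    have c\<xi>b: "continuous_on {0..1} (\<lambda>s. \<xi> s * b0 s)" by (intro continuous_intros c\<xi> cb)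
    define \<eta> where "\<eta> \<tau> = integral {0..\<tau>} (\<lambda>s. \<xi> s * b0 s)" for \<tau>
    have \<eta>': "(\<eta> has_real_derivative \<xi> \<tau> * b0 \<tau>) (at \<tau> within {0..1})" if "\<tau> \<in> {0..1}" for \<tau>
      unfolding \<eta>_def[abs_def] using integral_has_real_derivative[OF c\<xi>b that] .
    have \<eta>b: "\<bar>\<eta> \<tau>\<bar> \<le> 2 * \<epsilon>" if "\<tau> \<in> {0..1}" for \<tau>
    proof -
      have "norm (\<xi> s * b0 s) \<le> 2 * \<epsilon>" if "s \<in> {0..1}" for s
        using mult_mono[of "\<bar>\<xi> s\<bar>" 2 "\<bar>b0 s\<bar>" \<epsilon>] \<xi>b[OF that] bb(1)[OF that] by (simp add: abs_mult)
      then have "norm (\<eta> \<tau>) \<le> 2 * \<epsilon> * (\<tau> - 0)"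
        unfolding \<eta>_def using that
        by (intro integral_bound continuous_on_subset[OF c\<xi>b]) auto
      also have "\<dots> \<le> 2 * \<epsilon>" using that \<epsilon> by simp
      finally show ?thesis by simp
    qed
    have 0: "\<xi> 0 = 1" "\<eta> 0 = 0" by (simp_all add: \<xi>_def P_def \<eta>_def)
    have "\<bar>\<xi> 1 * y + \<eta> 1\<bar> < \<rho> \<and> F (y, a) = F (\<xi> 1 * y + \<eta> 1, a0)" if y: "\<bar>y\<bar> < \<rho> / 8" for y
    proof -
      define z where "z = \<xi> 1 * y + \<eta> 1"
      have "\<bar>\<xi> 1 * y\<bar> \<le> 2 * \<bar>y\<bar>" using \<xi>b[of 1] by (simp add: abs_mult mult_right_mono)
      moreover have "\<bar>z\<bar> \<le> \<bar>\<xi> 1 * y\<bar> + \<bar>\<eta> 1\<bar>" unfolding z_def by (rule abs_triangle_ineq)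
      ultimately have zb: "\<bar>z\<bar> \<le> 2 * \<bar>y\<bar> + 2 * \<epsilon>" using \<eta>b[of 1] by simp
      \<comment> \<open>The solution whose conserved value is \<open>z\<close>: it is at
        \<open>y\<close> over \<open>a\<close> (\<tau> = 1) and at \<open>z\<close> over
        \<open>a0\<close> (\<tau> = 0).\<close>
      define Y where "Y \<tau> = (z - \<eta> \<tau>) / \<xi> \<tau>" for \<tau>
      have Yb: "\<bar>Y \<tau>\<bar> < \<rho>" if "\<tau> \<in> {0..1}" for \<tau>
      proof -
        have "\<bar>z - \<eta> \<tau>\<bar> \<le> 2 * \<bar>y\<bar> + 4 * \<epsilon>" using zb \<eta>b[OF that] by linarith
        moreover have "\<bar>Y \<tau>\<bar> \<le> 2 * \<bar>z - \<eta> \<tau>\<bar>"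
        proof -
          have "\<bar>z - \<eta> \<tau>\<bar> * 1 \<le> \<bar>z - \<eta> \<tau>\<bar> * (2 * \<xi> \<tau>)" using \<xi>b[OF that] by (intro mult_left_mono) auto
          then show ?thesis using \<xi>b[OF that] by (simp add: Y_def divide_le_eq algebra_simps)
        qed
        moreover have "Y' < \<rho>" if "Y' \<le> 2 * m" "m \<le> 2 * \<bar>y\<bar> + 4 * \<epsilon>" for Y' m
          using that y \<epsilon>(3) by linarith
        ultimately show ?thesis by blast
      qed
      have Y': "(Y has_real_derivative - (b0 \<tau> + Y \<tau> * b1 \<tau>)) (at \<tau> within {0..1})" if "\<tau> \<in> {0..1}" for \<tau>
      proof -
        have \<xi>0: "\<xi> \<tau> \<noteq> 0" by (simp add: \<xi>_def)
        have "(Y has_real_derivative ((0 - \<xi> \<tau> * b0 \<tau>) * \<xi> \<tau> - (z - \<eta> \<tau>) * (\<xi> \<tau> * b1 \<tau>)) / (\<xi> \<tau> * \<xi> \<tau>)) (at \<tau> within {0..1})"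
          unfolding Y_def[abs_def]
          by (intro DERIV_divide DERIV_diff DERIV_const \<xi>' \<eta>' that \<xi>0)
        moreover have "((0 - \<xi> \<tau> * b0 \<tau>) * \<xi> \<tau> - (z - \<eta> \<tau>) * (\<xi> \<tau> * b1 \<tau>)) / (\<xi> \<tau> * \<xi> \<tau>) = - (b0 \<tau> + Y \<tau> * b1 \<tau>)"
          using \<xi>0 by (simp add: Y_def field_simps)
        ultimately show ?thesis by simp
      qed
      \<comment> \<open>Along this curve the change of \<open>F\<close> due to \<open>Y\<close>
        cancels the change due to \<open>a0 + \<tau> *\<^sub>R w\<close>, by
        \<open>pde\<close>.\<close>
      have "((\<lambda>\<tau>. F (Y \<tau>, a0 + \<tau> *\<^sub>R w)) has_derivative (\<lambda>s. 0)) (at \<tau> within {0..1})"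
        if \<tau>: "\<tau> \<in> {0..1}" for \<tau>
      proof -
        let ?D = "frechet_derivative F (at (Y \<tau>, a0 + \<tau> *\<^sub>R w))"
        have D: "(F has_derivative ?D) (at (Y \<tau>, a0 + \<tau> *\<^sub>R w))"
          using F[OF Yb[OF \<tau>] seg[OF \<tau>]] by (simp add: frechet_derivative_works)
        note lin = has_derivative_linear[OF D]
        have "((\<lambda>\<tau>. (Y \<tau>, a0 + \<tau> *\<^sub>R w)) has_derivative (\<lambda>s. ((- (b0 \<tau> + Y \<tau> * b1 \<tau>)) * s, s *\<^sub>R w))) (at \<tau> within {0..1})"
          by (intro has_derivative_Pair Y'[OF \<tau>, unfolded has_field_derivative_def]) (auto intro!: derivative_eq_intros)
        from has_derivative_compose[OF this D]
        have "((\<lambda>\<tau>. F (Y \<tau>, a0 + \<tau> *\<^sub>R w)) has_derivative (\<lambda>s. ?D ((- (b0 \<tau> + Y \<tau> * b1 \<tau>)) * s, s *\<^sub>R w))) (at \<tau> within {0..1})" .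
        moreover have "?D ((- (b0 \<tau> + Y \<tau> * b1 \<tau>)) * s, s *\<^sub>R w) = 0" for s
        proof -
          have "?D ((- (b0 \<tau> + Y \<tau> * b1 \<tau>)) * s, s *\<^sub>R w)
            = ?D (((- (b0 \<tau> + Y \<tau> * b1 \<tau>)) * s) *\<^sub>R (1, 0) + s *\<^sub>R (0, w))" by simp
          also have "\<dots> = (- (b0 \<tau> + Y \<tau> * b1 \<tau>)) * s * ?D (1, 0) + s * ?D (0, w)"
            unfolding linear_add[OF lin] linear_scale[OF lin] by simp
          also have "?D (0, w) = ?D (1, 0) * (b0 \<tau> + Y \<tau> * b1 \<tau>)"
            using pde[OF Yb[OF \<tau>] seg[OF \<tau>], of w] by (simp add: b0_def b1_def)
          finally show ?thesis by (simp add: algebra_simps)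
        qed
        ultimately show ?thesis by simp
      qed
      then have "\<exists>c. \<forall>\<tau>\<in>{0..1}. F (Y \<tau>, a0 + \<tau> *\<^sub>R w) = c"
        by (intro has_derivative_zero_constant) auto
      then obtain c where "\<And>\<tau>. \<tau> \<in> {0..1} \<Longrightarrow> F (Y \<tau>, a0 + \<tau> *\<^sub>R w) = c" by blast
      from this[of 1] this[of 0] have "F (Y 1, a0 + 1 *\<^sub>R w) = F (Y 0, a0 + 0 *\<^sub>R w)" by simp
      moreover have "Y 1 = y" using \<xi>b[of 1] by (simp add: Y_def z_def)
      moreover have "Y 0 = z" by (simp add: Y_def 0)
      ultimately have "F (y, a) = F (z, a0)" by (simp add: w_def)
      moreover have "\<bar>z\<bar> < \<rho>" using zb y \<epsilon> by linarith
      ultimately show ?thesis unfolding z_def by blast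
    qed
    then show ?thesis by blast
  qed
  with that \<delta> show thesis by blast
qed

section \<open>The rank condition\<close>

text \<open>Weights of a linear relation among three plane vectors are proportional to the minors of
  these vectors. The same weights serve for the triple (p, q) and the triple (r, s), so the two
  triples of minors are proportional to each other.\<close>

lemma proportional_minors:
  fixes A1 A3 A5 :: real
  assumes nz: "A1 \<noteq> 0 \<or> A3 \<noteq> 0 \<or> A5 \<noteq> 0"
    and a: "A1 * p1 + A3 * p2 + A5 * p3 = 0" "A1 * q1 + A3 * q2 + A5 * q3 = 0"
    and b: "A1 * r1 + A3 * r2 + A5 * r3 = 0" "A1 * s1 + A3 * s2 + A5 * s3 = 0"
    and det: "p2 * q3 - q2 * p3 \<noteq> 0" "p3 * q1 - q3 * p1 \<noteq> 0"
  shows "(p2 * q3 - q2 * p3) * (r3 * s1 - s3 * r1) = (p3 * q1 - q3 * p1) * (r2 * s3 - s2 * r3)"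
proof -
  have e: "A1 * (p3 * q1 - q3 * p1) = A3 * (p2 * q3 - q2 * p3)" using a by algebra
  have f: "A1 * (r3 * s1 - s3 * r1) = A3 * (r2 * s3 - s2 * r3)" using b by algebra
  have A1: "A1 \<noteq> 0"
  proof
    assume 0: "A1 = 0"
    then have 3: "A3 = 0" using e det by simp
    then have "A5 * (p2 * q3 - q2 * p3) = 0" using 0 a by algebra
    then show False using nz 0 3 det by simp
  qed
  then have A3: "A3 \<noteq> 0" using e det by auto
  have "A1 * A3 * ((p2 * q3 - q2 * p3) * (r3 * s1 - s3 * r1)) = A1 * A3 * ((p3 * q1 - q3 * p1) * (r2 * s3 - s2 * r3))"
    using e f by algebra
  then show ?thesis using A1 A3 by simp
qed

text \<open>The slope of \<open>f\<close> is the negative velocity of the level points: along \<open>f(x, a) = const\<close> one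
  has \<open>dx = - slope f da x a\<close>.\<close>

definition slope :: "(real \<times> 'a::euclidean_space \<Rightarrow> real) \<Rightarrow> 'a \<Rightarrow> real \<Rightarrow> 'a \<Rightarrow> real" where
  "slope f v x a = frechet_derivative f (at (x, a)) (0, v) / frechet_derivative f (at (x, a)) (1, 0)"

text \<open>The bracket [x y](a) of the overview. It is the Jacobian of axiom A3 divided by the
  derivatives of \<open>f\<close> in the first variable at \<open>(x, a)\<close> and
  \<open>(y, a)\<close>.\<close>

definition slope_det :: "(real \<times> real \<times> real \<Rightarrow> real) \<Rightarrow> real \<times> real \<Rightarrow> real \<Rightarrow> real \<Rightarrow> real" where
  "slope_det f a x y = slope f (1, 0) x a * slope f (0, 1) y a - slope f (0, 1) x a * slope f (1, 0) y a"

text \<open>Chain rule along a curve that moves \<open>i\<close>, \<open>j\<close>, \<open>k\<close>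
  with speeds \<open>u1\<close>, \<open>u2\<close>, \<open>u3\<close> and \<open>a\<close>,
  \<open>b\<close> with velocities \<open>v\<close>, \<open>w\<close>. For small times it stays in
  the open sets \<open>I\<close> and \<open>B\<close>, where \<open>\<Phi>\<close> of the values is
  0. Setting all velocities but one to 0 gives the individual relations.\<close>

lemma relation_differential:
  fixes f :: "real \<times> real \<times> real \<Rightarrow> real" and \<Phi> :: "R6 \<Rightarrow> real"
  assumes I: "open I" "i \<in> I" "j \<in> I" "k \<in> I" and B: "open B" "a \<in> B" "b \<in> B"
    and f: "\<And>x c. x \<in> I \<Longrightarrow> c \<in> B \<Longrightarrow> f differentiable (at (x, c))"
    and \<Phi>0: "\<And>i j k a b. i \<in> I \<Longrightarrow> j \<in> I \<Longrightarrow> k \<in> I \<Longrightarrow> a \<in> B \<Longrightarrow> b \<in> B \<Longrightarrow>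
      \<Phi> (f (i, a), f (i, b), f (j, a), f (j, b), f (k, a), f (k, b)) = 0"
    and G: "(\<Phi> has_derivative G) (at (f (i, a), f (i, b), f (j, a), f (j, b), f (k, a), f (k, b)))"
  shows "G (frechet_derivative f (at (i, a)) (u1, v), frechet_derivative f (at (i, b)) (u1, w),
            frechet_derivative f (at (j, a)) (u2, v), frechet_derivative f (at (j, b)) (u2, w),
            frechet_derivative f (at (k, a)) (u3, v), frechet_derivative f (at (k, b)) (u3, w)) = 0"
proof -
  have D: "((\<lambda>t. f (x + t * u, c + t *\<^sub>R v)) has_derivative (\<lambda>t. t * frechet_derivative f (at (x, c)) (u, v))) (at 0)"
    if "x \<in> I" "c \<in> B" for x c u v
  proof -
    have Df: "(f has_derivative frechet_derivative f (at (x, c))) (at (x + 0 * u, c + 0 *\<^sub>R v))"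
      using f[OF that] by (simp add: frechet_derivative_works)
    have "((\<lambda>t. (x + t * u, c + t *\<^sub>R v)) has_derivative (\<lambda>t. (t * u, t *\<^sub>R v))) (at 0)"
      by (auto intro!: derivative_eq_intros)
    from has_derivative_compose[OF this Df] show ?thesis
      using linear_scale[OF has_derivative_linear[OF Df], of _ "(u, v)"] by simp
  qed
  let ?c = "\<lambda>t. (f (i + t * u1, a + t *\<^sub>R v), f (i + t * u1, b + t *\<^sub>R w), f (j + t * u2, a + t *\<^sub>R v),
      f (j + t * u2, b + t *\<^sub>R w), f (k + t * u3, a + t *\<^sub>R v), f (k + t * u3, b + t *\<^sub>R w))"
  let ?d = "(frechet_derivative f (at (i, a)) (u1, v), frechet_derivative f (at (i, b)) (u1, w),
            frechet_derivative f (at (j, a)) (u2, v), frechet_derivative f (at (j, b)) (u2, w),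
            frechet_derivative f (at (k, a)) (u3, v), frechet_derivative f (at (k, b)) (u3, w))"
  have "(?c has_derivative (\<lambda>t. t *\<^sub>R ?d)) (at 0)"
    using I B by (auto intro!: has_derivative_Pair D)
  moreover have "(\<Phi> has_derivative G) (at (?c 0))" using G by simp
  ultimately have "((\<lambda>t. \<Phi> (?c t)) has_derivative (\<lambda>t. G (t *\<^sub>R ?d))) (at 0)"
    by (rule has_derivative_compose)
  moreover have "((\<lambda>t. \<Phi> (?c t)) has_derivative (\<lambda>t. 0)) (at 0)"
  proof -
    have ev: "\<forall>\<^sub>F t in nhds 0. x + t * u \<in> I" if "x \<in> I" for x u :: real
    proof -
      have "((\<lambda>t. x + t * u) \<longlongrightarrow> x + 0 * u) (nhds 0)" by (intro tendsto_intros filterlim_ident)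
      from topological_tendstoD[OF this I(1)] that show ?thesis by simp
    qed
    have ev': "\<forall>\<^sub>F t in nhds 0. c + t *\<^sub>R u \<in> B" if "c \<in> B" for c u :: "real \<times> real"
    proof -
      have "((\<lambda>t. c + t *\<^sub>R u) \<longlongrightarrow> c + 0 *\<^sub>R u) (nhds (0::real))" by (intro tendsto_intros filterlim_ident)
      from topological_tendstoD[OF this B(1)] that show ?thesis by simp
    qed
    have "\<forall>\<^sub>F t in nhds 0. \<Phi> (?c t) = 0"
      using ev[OF I(2), of u1] ev[OF I(3), of u2] ev[OF I(4), of u3] ev'[OF B(2), of v] ev'[OF B(3), of w]
      by eventually_elim (rule \<Phi>0)
    then obtain S where S: "open S" "0 \<in> S" "\<And>t. t \<in> S \<Longrightarrow> 0 = \<Phi> (?c t)"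
      unfolding eventually_nhds by force
    show ?thesis
      by (rule has_derivative_transform_within_open[OF has_derivative_const S])
  qed
  ultimately have "(\<lambda>t. G (t *\<^sub>R ?d)) = (\<lambda>t. 0)" using has_derivative_unique by blast
  from fun_cong[OF this, of 1] show ?thesis by simp
qed

text \<open>Moving \<open>a\<close> gives a relation among the three slopes at \<open>a\<close> with
  weights \<open>g1\<close>, \<open>g3\<close>, \<open>g5\<close> times the derivatives of
  \<open>f\<close> in the first variable; moving \<open>b\<close> gives one at \<open>b\<close> with
  \<open>g2\<close>, \<open>g4\<close>, \<open>g6\<close>. Moving \<open>i\<close>,
  \<open>j\<close>, \<open>k\<close> singly shows that the second weights are the negatives of the
  first, so \<open>proportional_minors\<close> applies.\<close>

lemma slope_det_relation:
  fixes f :: "real \<times> real \<times> real \<Rightarrow> real" and \<Phi> :: "R6 \<Rightarrow> real"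
  assumes I: "open I" "i \<in> I" "j \<in> I" "k \<in> I" and B: "open B" "a \<in> B" "b \<in> B"
    and f: "\<And>x c. x \<in> I \<Longrightarrow> c \<in> B \<Longrightarrow> f differentiable (at (x, c))"
    and fx: "\<And>x c. x \<in> I \<Longrightarrow> c \<in> B \<Longrightarrow> frechet_derivative f (at (x, c)) (1, 0) \<noteq> 0"
    and det: "slope_det f a j k \<noteq> 0" "slope_det f a k i \<noteq> 0"
    and \<Phi>0: "\<And>i j k a b. i \<in> I \<Longrightarrow> j \<in> I \<Longrightarrow> k \<in> I \<Longrightarrow> a \<in> B \<Longrightarrow> b \<in> B \<Longrightarrow>
      \<Phi> (f (i, a), f (i, b), f (j, a), f (j, b), f (k, a), f (k, b)) = 0"
    and G: "(\<Phi> has_derivative G) (at (f (i, a), f (i, b), f (j, a), f (j, b), f (k, a), f (k, b)))"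
    and G0: "G \<noteq> (\<lambda>_. 0)"
  shows "slope_det f a j k * slope_det f b k i = slope_det f a k i * slope_det f b j k"
proof -
  note lin = has_derivative_linear[OF G]
  define g1 where "g1 = G (1, 0, 0, 0, 0, 0)"
  define g2 where "g2 = G (0, 1, 0, 0, 0, 0)"
  define g3 where "g3 = G (0, 0, 1, 0, 0, 0)"
  define g4 where "g4 = G (0, 0, 0, 1, 0, 0)"
  define g5 where "g5 = G (0, 0, 0, 0, 1, 0)"
  define g6 where "g6 = G (0, 0, 0, 0, 0, 1)"
  note g_defs = g1_def g2_def g3_def g4_def g5_def g6_def
  have Gexp: "G (x1, x2, x3, x4, x5, x6) = x1 * g1 + x2 * g2 + x3 * g3 + x4 * g4 + x5 * g5 + x6 * g6"
    for x1 x2 x3 x4 x5 x6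
  proof -
    have "G (x1, x2, x3, x4, x5, x6) = G (x1 *\<^sub>R (1, 0, 0, 0, 0, 0) + x2 *\<^sub>R (0, 1, 0, 0, 0, 0)
      + x3 *\<^sub>R (0, 0, 1, 0, 0, 0) + x4 *\<^sub>R (0, 0, 0, 1, 0, 0) + x5 *\<^sub>R (0, 0, 0, 0, 1, 0) + x6 *\<^sub>R (0, 0, 0, 0, 0, 1))"
      by simp
    then show ?thesis
      unfolding linear_add[OF lin] linear_scale[OF lin] g_defs[symmetric] by simp
  qed
  have zero: "frechet_derivative f (at (x, c)) (0, 0) = 0" if "x \<in> I" "c \<in> B" for x c
    using linear_0[OF linear_frechet_derivative[OF f[OF that]]] by (simp add: zero_prod_def)
  note rel = relation_differential[OF I B f \<Phi>0 G, unfolded Gexp]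
  let ?p = "\<lambda>x c. frechet_derivative f (at (x, c)) (1, 0)"
  have r: "?p i a * g1 + ?p i b * g2 = 0" "?p j a * g3 + ?p j b * g4 = 0" "?p k a * g5 + ?p k b * g6 = 0"
    using rel[of 1 0 0 0 0] rel[of 0 0 0 1 0] rel[of 0 0 0 0 1] I B by (simp_all add: zero)
  have s: "slope f v x c * ?p x c = frechet_derivative f (at (x, c)) (0, v)" if "x \<in> I" "c \<in> B" for v x c
    using fx[OF that] by (simp add: slope_def)
  have s0: "slope f 0 x c = 0" if "x \<in> I" "c \<in> B" for x c
    using zero[OF that] by (simp add: slope_def zero_prod_def)
  have ra: "g1 * ?p i a * slope f v i a + g3 * ?p j a * slope f v j a + g5 * ?p k a * slope f v k a = 0" for v
    using rel[of 0 v 0 0 0] I B by (simp add: s[symmetric] s0 algebra_simps)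
  have rb0: "g2 * ?p i b * slope f v i b + g4 * ?p j b * slope f v j b + g6 * ?p k b * slope f v k b = 0" for v
    using rel[of 0 0 v 0 0] I B by (simp add: s[symmetric] s0 algebra_simps)
  have r': "g2 * ?p i b = - (g1 * ?p i a)" "g4 * ?p j b = - (g3 * ?p j a)" "g6 * ?p k b = - (g5 * ?p k a)"
    using r by (simp_all add: mult.commute[of "?p _ _"] eq_neg_iff_add_eq_0 add.commute)
  have rb: "g1 * ?p i a * slope f v i b + g3 * ?p j a * slope f v j b + g5 * ?p k a * slope f v k b = 0" for v
    using rb0[of v] unfolding r' by simp
  \<comment> \<open>If these weights vanish, so do the odd components of the gradient, and
    \<open>r\<close> then kills the even ones, contradicting \<open>G0\<close>.\<close>
  have "g1 * ?p i a \<noteq> 0 \<or> g3 * ?p j a \<noteq> 0 \<or> g5 * ?p k a \<noteq> 0"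
  proof (rule ccontr)
    assume "\<not> ?thesis"
    then have "g1 = 0" "g3 = 0" "g5 = 0" using fx I B by auto
    moreover from this have "g2 = 0" "g4 = 0" "g6 = 0" using r fx I B by auto
    ultimately have "G x = 0" for x by (cases x) (simp add: Gexp)
    then show False using G0 by auto
  qed
  from proportional_minors[OF this ra ra rb rb det[unfolded slope_det_def]]
  show ?thesis by (simp add: slope_det_def)
qed

section \<open>Affine slopes\<close>

text \<open>With E = f_x one has f_\<xi> = p E and f_\<eta> = q E. Expand f_\<xi>\<eta> =
  f_\<eta>\<xi>, replacing E_\<eta> by (q E)_x and E_\<xi> by (p E)_x: the terms p q E_x cancel and
  the nonzero factor E divides out.\<close>

lemma slope_integrability:
  fixes f :: "real \<times> real \<times> real \<Rightarrow> real"
  assumes S: "open S" "z \<in> S" and f: "Ck_on 2 S f"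
    and fx: "\<And>z. z \<in> S \<Longrightarrow> frechet_derivative f (at z) (1, 0) \<noteq> 0"
  defines "p \<equiv> \<lambda>z. slope f (1, 0) (fst z) (snd z)" and "q \<equiv> \<lambda>z. slope f (0, 1) (fst z) (snd z)"
  shows "p z * frechet_derivative q (at z) (1, 0) - q z * frechet_derivative p (at z) (1, 0) =
    frechet_derivative q (at z) (0, 1, 0) - frechet_derivative p (at z) (0, 0, 1)"
proof -
  define E where "E = (\<lambda>y. frechet_derivative f (at y) (1, 0))"
  have Dk: "Ck_on (Suc 0) S (\<lambda>y. frechet_derivative f (at y) v)" for v
    using f by (cases v) (simp add: numeral_2_eq_2)
  have Dz: "((\<lambda>y. frechet_derivative f (at y) v) has_derivative
      frechet_derivative (\<lambda>y. frechet_derivative f (at y) v) (at z)) (at z)" for v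
    using Ck_on_SucE[OF Dk S(2)] .
  have quot: "frechet_derivative (\<lambda>y. frechet_derivative f (at y) (0, v)) (at z) w
      = frechet_derivative (\<lambda>z. slope f v (fst z) (snd z)) (at z) w * E z
        + slope f v (fst z) (snd z) * frechet_derivative E (at z) w" for v w
  proof -
    let ?s = "\<lambda>z. slope f v (fst z) (snd z)"
    have "Ck_on (Suc 0) S (\<lambda>y. frechet_derivative f (at y) (0, v) / frechet_derivative f (at y) (1, 0))"
      by (intro Ck_on_divide S(1) Dk fx)
    then have "Ck_on (Suc 0) S ?s" by (simp add: slope_def)
    from Ck_on_SucE[OF this S(2)]
    have "((\<lambda>y. ?s y * E y) has_derivative
        (\<lambda>w. ?s z * frechet_derivative E (at z) w + frechet_derivative ?s (at z) w * E z)) (at z)"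
      using has_derivative_mult[OF _ Dz[of "(1, 0)"]] unfolding E_def by blast
    then have "((\<lambda>y. frechet_derivative f (at y) (0, v)) has_derivative
        (\<lambda>w. ?s z * frechet_derivative E (at z) w + frechet_derivative ?s (at z) w * E z)) (at z)"
    proof (rule has_derivative_transform_within_open[OF _ S])
      show "?s y * E y = frechet_derivative f (at y) (0, v)" if "y \<in> S" for y
        using fx[OF that] by (simp add: slope_def E_def)
    qed
    from fun_cong[OF has_derivative_unique[OF this Dz], of w] show ?thesis by linarith
  qed
  note sym = symmetric_second_derivative[OF S f]
  have 1: "frechet_derivative (\<lambda>y. frechet_derivative f (at y) (0, 1, 0)) (at z) (0, 0, 1) =
    frechet_derivative (\<lambda>y. frechet_derivative f (at y) (0, 0, 1)) (at z) (0, 1, 0)" by (rule sym)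
  have 2: "frechet_derivative E (at z) (0, v) = frechet_derivative (\<lambda>y. frechet_derivative f (at y) (0, v)) (at z) (1, 0)" for v
    unfolding E_def by (rule sym)
  have "frechet_derivative p (at z) (0, 0, 1) * E z + p z * (frechet_derivative q (at z) (1, 0) * E z + q z * frechet_derivative E (at z) (1, 0))
    = frechet_derivative q (at z) (0, 1, 0) * E z + q z * (frechet_derivative p (at z) (1, 0) * E z + p z * frechet_derivative E (at z) (1, 0))"
    using 1 unfolding quot 2 p_def q_def .
  then have "E z * (p z * frechet_derivative q (at z) (1, 0) - q z * frechet_derivative p (at z) (1, 0)) =
    E z * (frechet_derivative q (at z) (0, 1, 0) - frechet_derivative p (at z) (0, 0, 1))"
    by (simp add: algebra_simps)
  then show ?thesis using fx[OF S(2)] by (simp add: E_def)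
qed

lemma slope_det_same [simp]: "slope_det f a x x = 0"
  by (simp add: slope_det_def)

lemma slope_det_commute: "slope_det f a x y = - slope_det f a y x"
  by (simp add: slope_det_def)

locale regular_representation =
  fixes r :: enat and I :: "real set" and B :: "(real \<times> real) set" and f :: "real \<times> real \<times> real \<Rightarrow> real"
  assumes r: "2 \<le> r" and I: "open I" "is_interval I" and B: "open B" and f: "Cr_on r (I \<times> B) f"
    and fx: "\<And>x a. x \<in> I \<Longrightarrow> a \<in> B \<Longrightarrow> frechet_derivative f (at (x, a)) (1, 0) \<noteq> 0"
begin

lemma open_IB: "open (I \<times> B)"
  using I B by (simp add: open_Times)

lemma f_Ck2: "Ck_on 2 (I \<times> B) f"
  using f r unfolding Cr_on_def by (metis numeral_eq_enat)

lemma f_differentiable: "x \<in> I \<Longrightarrow> a \<in> B \<Longrightarrow> f differentiable (at (x, a))"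
  using f_Ck2 by (simp add: numeral_2_eq_2)

lemma slope_Ck:
  assumes "enat (Suc k) \<le> r"
  shows "Ck_on k (I \<times> B) (\<lambda>z. slope f v (fst z) (snd z))"
proof -
  have fk: "Ck_on (Suc k) (I \<times> B) f" using f assms unfolding Cr_on_def by blast
  have D: "Ck_on k (I \<times> B) (\<lambda>z. frechet_derivative f (at z) w)" for w
    using fk by (cases w) simp
  have "Ck_on k (I \<times> B) (\<lambda>z. frechet_derivative f (at z) (0, v) / frechet_derivative f (at z) (1, 0))"
    by (intro Ck_on_divide open_IB D) (use fx in auto)
  then show ?thesis by (simp add: slope_def)
qed

lemma slope_Ck_fst:
  assumes "enat (Suc k) \<le> r" "a \<in> B"
  shows "Ck_on k I (\<lambda>x. slope f v x a)"
proof -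
  have "Ck_on k I (\<lambda>x. (x, a))" by (intro Ck_on_Pair I Ck_on_const Ck_on_ident)
  moreover have "(\<lambda>x. (x, a)) ` I \<subseteq> I \<times> B" using assms(2) by auto
  ultimately have "Ck_on k I (\<lambda>x. slope f v (fst (x, a)) (snd (x, a)))"
    using Ck_on_compose[where f="\<lambda>x. (x, a)", OF I(1) open_IB _ slope_Ck[OF assms(1), of v]] by blast
  then show ?thesis by simp
qed

lemma slope_continuous_snd:
  assumes "x \<in> I"
  shows "continuous_on B (\<lambda>a. slope f v x a)"
proof -
  have "enat (Suc 0) \<le> r" using r by (metis One_nat_def one_enat_def one_le_numeral order_trans)
  from Ck_on_imp_continuous_on[OF slope_Ck[OF this, of v]]
  have "continuous_on (I \<times> B) (\<lambda>z. slope f v (fst z) (snd z))" .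
  moreover have "continuous_on B (\<lambda>a. (x, a))" by (intro continuous_intros)
  moreover have "(\<lambda>a. (x, a)) ` B \<subseteq> I \<times> B" using assms by auto
  ultimately have "continuous_on B (\<lambda>a. slope f v (fst (x, a)) (snd (x, a)))"
    using continuous_on_compose2[where f="\<lambda>a. (x, a)" and s=B] by blast
  then show ?thesis by simp
qed

lemma slope_linear:
  assumes "x \<in> I" "a \<in> B"
  shows "slope f (s, t) x a = s * slope f (1, 0) x a + t * slope f (0, 1) x a"
proof -
  note lin = linear_frechet_derivative[OF f_differentiable[OF assms]]
  have "(0, s, t) = s *\<^sub>R (0::real, 1::real, 0::real) + t *\<^sub>R (0, 0, 1)" by simp
  then show ?thesis
    unfolding slope_def by (simp only: linear_add[OF lin] linear_scale[OF lin] add_divide_distrib real_scaleR_def times_divide_eq_right)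
qed

end

text \<open>What A3 and A4 say about slopes alone, once \<open>\<Phi>\<close> has been
  eliminated.\<close>

locale slope_geometry = regular_representation +
  assumes det: "\<And>x y a. x \<in> I \<Longrightarrow> y \<in> I \<Longrightarrow> x \<noteq> y \<Longrightarrow> a \<in> B \<Longrightarrow> slope_det f a x y \<noteq> 0"
    and rel: "\<And>i j k a b. i \<in> I \<Longrightarrow> j \<in> I \<Longrightarrow> k \<in> I \<Longrightarrow> i \<noteq> j \<Longrightarrow> j \<noteq> k \<Longrightarrow> k \<noteq> i \<Longrightarrow> a \<in> B \<Longrightarrow> b \<in> B \<Longrightarrow>
      slope_det f a j k * slope_det f b k i = slope_det f a k i * slope_det f b j k"
begin

text \<open>Cramer's rule in the basis of slopes of \<open>j\<close> and \<open>k\<close> at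
  \<open>a\<close> has quotients of minors at \<open>a\<close> as coefficients; by
  \<open>rel\<close> these quotients may be evaluated at the fixed point \<open>a0\<close>
  instead.\<close>

lemma slope_decomposition:
  assumes jk: "j \<in> I" "k \<in> I" "j \<noteq> k" and x: "x \<in> I" and a: "a \<in> B" "a0 \<in> B"
  shows "slope f v x a = slope_det f a0 x k / slope_det f a0 j k * slope f v j a
    + slope_det f a0 j x / slope_det f a0 j k * slope f v k a"
proof -
  let ?d = "slope_det f a j k" and ?e = "slope_det f a0 j k"
  have d: "?d \<noteq> 0" "?e \<noteq> 0" using det jk a by auto
  have 1: "slope_det f a x k * ?e = slope_det f a0 x k * ?d"
  \<comment> \<open>\<open>rel\<close> speaks of distinct points only; when \<open>x\<close> is
    \<open>j\<close> or \<open>k\<close> the two sides agree by inspection.\<close>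
  proof (cases "x = j \<or> x = k")
    case False
    then have "?d * slope_det f a0 k x = slope_det f a k x * ?e"
      using jk by (intro rel x jk a) auto
    then show ?thesis unfolding slope_det_commute[of f _ k x] by algebra
  qed auto
  have 2: "slope_det f a j x * ?e = slope_det f a0 j x * ?d"
  proof (cases "x = j \<or> x = k")
    case False
    then have "slope_det f a x j * ?e = ?d * slope_det f a0 x j"
      using jk by (intro rel x jk a) auto
    then show ?thesis unfolding slope_det_commute[of f _ x j] by algebra
  qed auto
  obtain s t where v: "v = (s, t)" by fastforce
  have sd: "slope f v x a * ?d = slope_det f a x k * slope f v j a + slope_det f a j x * slope f v k a"
    unfolding v slope_linear[OF x a(1), of s t] slope_linear[OF jk(1) a(1), of s t] slope_linear[OF jk(2) a(1), of s t] slope_det_def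
    by algebra
  define l where "l = slope_det f a0 x k / ?e"
  define m where "m = slope_det f a0 j x / ?e"
  have lm: "slope_det f a x k = l * ?d" "slope_det f a j x = m * ?d"
    unfolding l_def m_def times_divide_eq_left eq_divide_eq using 1 2 d by simp_all
  have "slope f v x a * ?d = (l * slope f v j a + m * slope f v k a) * ?d"
    unfolding sd lm by algebra
  then show ?thesis using d by (simp add: l_def m_def)
qed

text \<open>Differentiating the decomposition at \<open>a0\<close> and inserting it into
  \<open>slope_integrability\<close> gives the Wronskian equation that
  \<open>affine_coordinate\<close> needs. The factor \<open>c x\<close> is the reciprocal of the
  derivative of \<open>X\<close>; the shift \<open>m\<close> records that \<open>X\<close> has been
  translated to vanish at \<open>x0\<close>.\<close>

lemma affine_slope:
  assumes x0: "x0 \<in> I" and a0: "a0 \<in> B"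
  obtains X c j k c1 c2 d1 d2 m where
    "j \<in> I" "k \<in> I" "j \<noteq> k" "c1 * d2 - c2 * d1 = 1" "X x0 = 0"
    "\<And>x. x \<in> I \<Longrightarrow> c x \<noteq> 0" "\<And>x. x \<in> I \<Longrightarrow> (X has_real_derivative 1 / c x) (at x)"
    "Cr_on r I X"
    "\<And>x a v. x \<in> I \<Longrightarrow> a \<in> B \<Longrightarrow> slope f v x a = c x *
      (d2 * slope f v j a - d1 * slope f v k a + (X x + m) * (c1 * slope f v k a - c2 * slope f v j a))"
proof -
  obtain e where "e > 0" "cball x0 e \<subseteq> I" using I(1) x0 open_contains_cball by blast
  then have "x0 + e \<in> I" "x0 \<noteq> x0 + e" by (auto simp: subset_iff dist_real_def)
  then obtain j k where jk: "j \<in> I" "k \<in> I" "j \<noteq> k" using x0 by blast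
  let ?e = "slope_det f a0 j k"
  have d0: "?e \<noteq> 0" using det jk a0 by auto
  define l where "l x = slope_det f a0 x k / ?e" for x
  define m where "m x = slope_det f a0 j x / ?e" for x
  have dec: "slope f v x a = l x * slope f v j a + m x * slope f v k a" if "x \<in> I" "a \<in> B" for v x a
    unfolding l_def m_def using slope_decomposition[OF jk that a0] .
  have lmk: "Ck_on n I l" "Ck_on n I m" if "enat (Suc n) \<le> r" for n
    unfolding l_def[abs_def] m_def[abs_def] slope_det_def divide_inverse
    by (intro Ck_on_mult Ck_on_diff I Ck_on_const slope_Ck_fst that a0)+
  have r2: "enat (Suc (Suc 0)) \<le> r" using r by (metis numeral_2_eq_2 numeral_eq_enat)
  have D: "(l has_real_derivative deriv l x) (at x)" "(m has_real_derivative deriv m x) (at x)" if "x \<in> I" for x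
    using lmk[OF r2] that by (simp_all add: DERIV_deriv_iff_real_differentiable)
  define p where "p = (\<lambda>z. slope f (1, 0) (fst z) (snd z))"
  define q where "q = (\<lambda>z. slope f (0, 1) (fst z) (snd z))"
  have along: "((\<lambda>t. slope f v (x + t * fst w) (a0 + t *\<^sub>R snd w)) has_real_derivative
      frechet_derivative (\<lambda>z. slope f v (fst z) (snd z)) (at (x, a0)) w) (at 0)" if "x \<in> I" for v x w
  proof -
    have "(\<lambda>z. slope f v (fst z) (snd z)) differentiable at ((x, a0) + 0 *\<^sub>R w)"
      using slope_Ck[OF r2, of v] that a0 by simp
    from has_real_derivative_along_line[OF this] show ?thesis by simp
  qed
  have ev: "\<forall>\<^sub>F t in nhds 0. a0 + t *\<^sub>R w \<in> B" for w
  proof -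
    have "((\<lambda>t. a0 + t *\<^sub>R w) \<longlongrightarrow> a0 + 0 *\<^sub>R w) (nhds (0::real))" by (intro tendsto_intros filterlim_ident)
    from topological_tendstoD[OF this B] a0 show ?thesis by simp
  qed
  \<comment> \<open>The coefficients \<open>l x\<close> and \<open>m x\<close> do not depend on the
    point of the second manifold, so derivatives of slopes in its directions decompose with the same
    coefficients.\<close>
  have transversal: "frechet_derivative (\<lambda>z. slope f v (fst z) (snd z)) (at (x, a0)) (0, w) =
      l x * frechet_derivative (\<lambda>z. slope f v (fst z) (snd z)) (at (j, a0)) (0, w)
      + m x * frechet_derivative (\<lambda>z. slope f v (fst z) (snd z)) (at (k, a0)) (0, w)" if x: "x \<in> I" for v x w
  proof (rule DERIV_unique)
    show "((\<lambda>t. slope f v x (a0 + t *\<^sub>R w)) has_real_derivative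
        frechet_derivative (\<lambda>z. slope f v (fst z) (snd z)) (at (x, a0)) (0, w)) (at 0)"
      using along[OF x, of v "(0, w)"] by simp
    have "((\<lambda>t. l x * slope f v j (a0 + t *\<^sub>R w) + m x * slope f v k (a0 + t *\<^sub>R w)) has_real_derivative
      l x * frechet_derivative (\<lambda>z. slope f v (fst z) (snd z)) (at (j, a0)) (0, w)
      + m x * frechet_derivative (\<lambda>z. slope f v (fst z) (snd z)) (at (k, a0)) (0, w)) (at 0)"
      using along[OF jk(1), of v "(0, w)"] along[OF jk(2), of v "(0, w)"]
      by (intro DERIV_add DERIV_cmult) simp_all
    moreover have ev2: "\<forall>\<^sub>F t in nhds 0. l x * slope f v j (a0 + t *\<^sub>R w) + m x * slope f v k (a0 + t *\<^sub>R w) = slope f v x (a0 + t *\<^sub>R w)"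
      using ev[of w] by eventually_elim (simp add: dec x)
    ultimately show "((\<lambda>t. slope f v x (a0 + t *\<^sub>R w)) has_real_derivative
      l x * frechet_derivative (\<lambda>z. slope f v (fst z) (snd z)) (at (j, a0)) (0, w)
      + m x * frechet_derivative (\<lambda>z. slope f v (fst z) (snd z)) (at (k, a0)) (0, w)) (at 0)"
      unfolding DERIV_cong_ev[OF refl ev2 refl] by blast
  qed
  have longitudinal: "frechet_derivative (\<lambda>z. slope f v (fst z) (snd z)) (at (x, a0)) (1, 0) =
      deriv l x * slope f v j a0 + deriv m x * slope f v k a0" if x: "x \<in> I" for v x
  proof (rule DERIV_unique)
    have "((\<lambda>t. slope f v (t + x) a0) has_real_derivative
        frechet_derivative (\<lambda>z. slope f v (fst z) (snd z)) (at (x, a0)) (1, 0)) (at 0)"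
      using along[OF x, of v "(1, 0)"] by (simp add: add.commute)
    from iffD2[OF DERIV_shift[of "\<lambda>t. slope f v t a0" _ 0 x] this]
    show "((\<lambda>t. slope f v t a0) has_real_derivative
        frechet_derivative (\<lambda>z. slope f v (fst z) (snd z)) (at (x, a0)) (1, 0)) (at x)"
      unfolding add_0 .
    have "((\<lambda>t. l t * slope f v j a0 + m t * slope f v k a0) has_real_derivative
      deriv l x * slope f v j a0 + deriv m x * slope f v k a0) (at x)"
      by (intro DERIV_add DERIV_cmult_right D x)
    then show "((\<lambda>t. slope f v t a0) has_real_derivative
      deriv l x * slope f v j a0 + deriv m x * slope f v k a0) (at x)"
      by (rule has_field_derivative_transform_within_open[OF _ I(1) x]) (simp add: dec a0)
  qed
  \<comment> \<open>The curl at \<open>a0\<close> of the covector field of slopes of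
    \<open>y\<close>, divided by the minor of \<open>j\<close> and \<open>k\<close>. By
    \<open>transversal\<close> the curl for \<open>x\<close> is the combination of those for
    \<open>j\<close> and \<open>k\<close> with weights \<open>l x\<close> and
    \<open>m x\<close>.\<close>
  define cc where "cc y = (frechet_derivative q (at (y, a0)) (0, 1, 0) - frechet_derivative p (at (y, a0)) (0, 0, 1)) / ?e" for y
  have W: "l x * deriv m x - m x * deriv l x = cc j * l x + cc k * m x" if x: "x \<in> I" for x
  proof -
    have "p (x, a0) * frechet_derivative q (at (x, a0)) (1, 0) - q (x, a0) * frechet_derivative p (at (x, a0)) (1, 0) =
      frechet_derivative q (at (x, a0)) (0, 1, 0) - frechet_derivative p (at (x, a0)) (0, 0, 1)"
      unfolding p_def q_def by (rule slope_integrability[OF open_IB _ f_Ck2]) (use x a0 fx in auto)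
    moreover have "p (x, a0) * frechet_derivative q (at (x, a0)) (1, 0) - q (x, a0) * frechet_derivative p (at (x, a0)) (1, 0)
      = (l x * deriv m x - m x * deriv l x) * ?e"
      unfolding p_def q_def longitudinal[OF x] fst_conv snd_conv dec[OF x a0] slope_det_def by algebra
    moreover have "frechet_derivative q (at (x, a0)) (0, 1, 0) - frechet_derivative p (at (x, a0)) (0, 0, 1) = (cc j * l x + cc k * m x) * ?e"
      unfolding cc_def p_def q_def transversal[OF x] using d0 by (simp add: field_simps)
    ultimately show ?thesis using d0 by simp
  qed
  have lmdet: "l x * m y - m x * l y \<noteq> 0" if "x \<in> I" "y \<in> I" "x \<noteq> y" for x y
  proof -
    have "slope_det f a0 x y = (l x * m y - m x * l y) * ?e"
      unfolding slope_det_def dec[OF that(1) a0] dec[OF that(2) a0] by algebra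
    then show ?thesis using det[OF that a0] by auto
  qed
  obtain d1 d2 where cd: "cc j * d2 - cc k * d1 = 1"
    and cnz: "\<And>x. x \<in> I \<Longrightarrow> cc j * l x + cc k * m x \<noteq> 0"
    and X': "\<And>x. x \<in> I \<Longrightarrow> ((\<lambda>x. (d1 * l x + d2 * m x) / (cc j * l x + cc k * m x)) has_real_derivative
        1 / (cc j * l x + cc k * m x)) (at x)"
  proof (rule affine_coordinate[OF I(1) _ D(1) D(2) W lmdet])
    show "I \<noteq> {}" using x0 by blast
  qed (assumption+, rule that)
  define X0 where "X0 x = (d1 * l x + d2 * m x) / (cc j * l x + cc k * m x)" for x
  define c where "c x = cc j * l x + cc k * m x" for x
  have X0': "((\<lambda>x. X0 x - X0 x0) has_real_derivative 1 / c x) (at x)" if "x \<in> I" for x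
    using DERIV_diff[OF X'[OF that] DERIV_const[of "X0 x0"]] by (simp add: X0_def c_def)
  \<comment> \<open>The defining quotient only shows one order less; the missing order comes from
    the derivative \<open>1 / c x\<close>.\<close>
  have "Cr_on r I (\<lambda>x. X0 x - X0 x0)"
  proof (rule Cr_onI)
    fix n assume n: "enat (Suc n) \<le> r"
    show "Ck_on (Suc n) I (\<lambda>x. X0 x - X0 x0)"
    proof (rule Ck_on_Suc_real[OF I(1) X0'])
      show "Ck_on n I (\<lambda>x. 1 / c x)" unfolding c_def
        by (intro Ck_on_divide Ck_on_add Ck_on_mult I Ck_on_const lmk n cnz)
    qed
  qed (use r in \<open>metis one_le_numeral order_trans\<close>)
  moreover have "slope f v x a = c x *
      (d2 * slope f v j a - d1 * slope f v k a + (X0 x - X0 x0 + X0 x0) * (cc j * slope f v k a - cc k * slope f v j a))"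
    if "x \<in> I" "a \<in> B" for x a v
  proof -
    have cX: "d1 * l x + d2 * m x = c x * X0 x" using cnz[OF that(1)] by (simp add: c_def X0_def)
    \<comment> \<open>Inversion of the matrix with rows \<open>(cc j, cc k)\<close> and
      \<open>(d1, d2)\<close>, whose determinant is 1.\<close>
    have "l x = d2 * c x - cc k * (d1 * l x + d2 * m x)" "m x = cc j * (d1 * l x + d2 * m x) - d1 * c x"
      using cd unfolding c_def by algebra+
    then have lm: "l x = d2 * c x - cc k * (c x * X0 x)" "m x = cc j * (c x * X0 x) - d1 * c x"
      unfolding cX .
    show ?thesis unfolding dec[OF that] lm by algebra
  qed
  moreover have "c x \<noteq> 0" if "x \<in> I" for x unfolding c_def by (rule cnz[OF that])
  ultimately show thesis
    by (intro that[OF jk cd, of "\<lambda>x. X0 x - X0 x0" c "X0 x0"] X0') simp_all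
qed

end

section \<open>Integration along the characteristics and the new coordinates\<close>

context slope_geometry
begin

text \<open>By linearity in \<open>v\<close> only two continuous functions have to be bounded on
  \<open>K\<close>. This supplies the bound \<open>M\<close> of
  \<open>affine_characteristics\<close>.\<close>

lemma slope_bounded:
  assumes "x \<in> I" "K \<subseteq> B" "compact K"
  obtains M where "\<And>a v. a \<in> K \<Longrightarrow> \<bar>slope f v x a\<bar> \<le> M * norm v"
proof -
  have bd: "\<exists>M. \<forall>a\<in>K. \<bar>slope f v x a\<bar> \<le> M" for v
  proof -
    have "bounded ((\<lambda>a. slope f v x a) ` K)"
      by (intro compact_imp_bounded compact_continuous_image continuous_on_subset[OF slope_continuous_snd] assms)
    then show ?thesis by (auto simp: bounded_real)
  qed
  obtain M1 where M1: "\<forall>a\<in>K. \<bar>slope f (1, 0) x a\<bar> \<le> M1" using bd by blast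
  obtain M2 where M2: "\<forall>a\<in>K. \<bar>slope f (0, 1) x a\<bar> \<le> M2" using bd by blast
  have "\<bar>slope f v x a\<bar> \<le> (M1 + M2) * norm v" if a: "a \<in> K" for a v
  proof -
    obtain s t where v: "v = (s, t)" by fastforce
    have st: "\<bar>s\<bar> \<le> norm v" "\<bar>t\<bar> \<le> norm v"
      unfolding v real_norm_def[symmetric] by (rule norm_fst_le, rule norm_snd_le)
    have "\<bar>slope f v x a\<bar> \<le> \<bar>s\<bar> * \<bar>slope f (1, 0) x a\<bar> + \<bar>t\<bar> * \<bar>slope f (0, 1) x a\<bar>"
      using slope_linear[OF assms(1), of a s t] a assms(2)
        abs_triangle_ineq[of "s * slope f (1, 0) x a" "t * slope f (0, 1) x a"]
      by (auto simp: v abs_mult)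
    also have "\<dots> \<le> norm v * M1 + norm v * M2"
      using M1 M2 a st by (intro add_mono mult_mono) auto
    finally show ?thesis by (simp add: algebra_simps)
  qed
  with that show thesis by blast
qed

text \<open>Along the characteristics every function \<open>f(\<cdot>, a)\<close> is \<open>f(\<cdot>, a0)\<close> precomposed with an affine
  map, in the coordinate in which the slopes are affine.\<close>

lemma canonical_form:
  assumes x0: "x0 \<in> I" and a0: "a0 \<in> B"
  obtains I' X G W B' \<Psi> \<Psi>' V J h where
    "open I'" "x0 \<in> I'" "I' \<subseteq> I" "open W" "homeomorphism I' W X G" "Cr_on r I' X" "Cr_on r W G"
    "open B'" "a0 \<in> B'" "B' \<subseteq> B" "open V" "homeomorphism B' V \<Psi> \<Psi>'" "Cr_on r B' \<Psi>" "Cr_on r V \<Psi>'"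
    "scaling_function r J h"
    "\<And>x a. x \<in> I' \<Longrightarrow> a \<in> B' \<Longrightarrow> f (x, a) \<in> h ` J \<and> the_inv_into J h (f (x, a)) = X x * fst (\<Psi> a) + snd (\<Psi> a)"
proof -
  have r1: "1 \<le> r" using r by (metis one_le_numeral order_trans)
  obtain X c j k c1 c2 d1 d2 m where jk: "j \<in> I" "k \<in> I" "j \<noteq> k" and cd: "c1 * d2 - c2 * d1 = 1" and X0: "X x0 = 0"
    and c: "\<And>x. x \<in> I \<Longrightarrow> c x \<noteq> 0" and X': "\<And>x. x \<in> I \<Longrightarrow> (X has_real_derivative 1 / c x) (at x)"
    and CrX: "Cr_on r I X"
    and aff: "\<And>x a v. x \<in> I \<Longrightarrow> a \<in> B \<Longrightarrow> slope f v x a = c x *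
      (d2 * slope f v j a - d1 * slope f v k a + (X x + m) * (c1 * slope f v k a - c2 * slope f v j a))"
    by (rule affine_slope[OF x0 a0]) (rule that, assumption+)
  have "deriv X x \<noteq> 0" if "x \<in> I" for x using DERIV_imp_deriv[OF X'[OF that]] c[OF that] by simp
  note inv = Cr_inverse_real[OF r1 I CrX this]
  define W0 where "W0 = X ` I"
  define G where "G = the_inv_into I X"
  have W0: "open W0" "0 \<in> W0" using inv(2) X0 x0 by (auto simp: W0_def intro: rev_image_eqI)
  have hom: "homeomorphism I W0 X G" and CrG: "Cr_on r W0 G" using inv(3,4) by (auto simp: W0_def G_def)
  have GI: "G y \<in> I" "X (G y) = y" if "y \<in> W0" for y
    using hom that by (auto simp: homeomorphism_def)
  have GX: "G (X x) = x" if "x \<in> I" for x using hom that by (simp add: homeomorphism_def)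
  have G': "(G has_real_derivative c (G y)) (at y)" if y: "y \<in> W0" for y
  proof -
    have "continuous (at y) G"
      using hom y W0(1) by (simp add: homeomorphism_def continuous_on_eq_continuous_at)
    from has_field_derivative_inverse_basic[OF X'[OF GI(1)[OF y]] _ this W0(1) y GI(2)]
    show ?thesis using c[OF GI(1)[OF y]] by simp
  qed
  obtain \<rho> where \<rho>: "\<rho> > 0" "ball 0 \<rho> \<subseteq> W0" using W0 openE by blast
  have \<rho>W: "y \<in> W0" if "\<bar>y\<bar> < \<rho>" for y using \<rho>(2) that by (auto simp: subset_iff)
  obtain \<beta> where \<beta>: "\<beta> > 0" "cball a0 \<beta> \<subseteq> B" using B a0 open_contains_cball by blast
  have \<beta>B: "a \<in> B" if "a \<in> ball a0 \<beta>" for a using \<beta>(2) that ball_subset_cball by blast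
  \<comment> \<open>\<open>f\<close> rewritten in the coordinate \<open>X\<close>, with
    \<open>G\<close> its inverse.\<close>
  define F where "F z = f (G (fst z), snd z)" for z
  have CrF: "Cr_on r (W0 \<times> B) F"
    unfolding F_def[abs_def]
  proof (rule Cr_on_compose[OF _ open_IB _ f])
    show o: "open (W0 \<times> B)" using W0 B by (simp add: open_Times)
    show "(\<lambda>z. (G (fst z), snd z)) ` (W0 \<times> B) \<subseteq> I \<times> B" using GI by auto
    show "Cr_on r (W0 \<times> B) (\<lambda>z. (G (fst z), snd z))"
      unfolding Cr_on_def
    proof (intro allI impI Ck_on_Pair o Ck_on_snd Ck_on_ident)
      fix n assume n: "enat n \<le> r"
      show "Ck_on n (W0 \<times> B) (\<lambda>z. G (fst z))"
        by (rule Ck_on_compose[OF o W0(1) _ _ Ck_on_fst[OF o Ck_on_ident]])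
          (use CrG n in \<open>auto simp: Cr_on_def\<close>)
    qed
  qed
  have DF: "(F has_derivative (\<lambda>w. frechet_derivative f (at (G y, a)) (c (G y) * fst w, snd w))) (at (y, a))"
    if "y \<in> W0" "a \<in> B" for y a
  proof -
    have "((\<lambda>z. G (fst z)) has_derivative (\<lambda>w. c (G y) * fst w)) (at (y, a))"
    proof (rule has_derivative_compose[where g=G and f=fst and f'=fst and g'="\<lambda>s. c (G y) * s"])
      show "(fst has_derivative fst) (at (y, a))" using has_derivative_fst[OF has_derivative_ident] .
      show "(G has_derivative (\<lambda>s. c (G y) * s)) (at (fst (y, a)))"
        using G'[OF that(1)] by (simp add: has_field_derivative_def)
    qed
    then have "((\<lambda>z. (G (fst z), snd z)) has_derivative (\<lambda>w. (c (G y) * fst w, snd w))) (at (y, a))"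
      by (intro has_derivative_Pair has_derivative_snd has_derivative_ident)
    moreover have "(f has_derivative frechet_derivative f (at (G y, a))) (at (G (fst (y, a)), snd (y, a)))"
      using f_differentiable[OF GI(1)[OF that(1)] that(2)] by (simp add: frechet_derivative_works)
    ultimately show ?thesis unfolding F_def[abs_def] by (rule has_derivative_compose)
  qed
  have dF: "F differentiable (at (y, a))" if "y \<in> W0" "a \<in> B" for y a
    using DF[OF that] differentiable_def by blast
  have F10: "frechet_derivative F (at (y, a)) (1, 0) = c (G y) * frechet_derivative f (at (G y, a)) (1, 0)"
    if "y \<in> W0" "a \<in> B" for y a
  proof -
    have "frechet_derivative F (at (y, a)) (1, 0) = frechet_derivative f (at (G y, a)) (c (G y) *\<^sub>R (1, 0))"
      using fun_cong[OF frechet_derivative_at[OF DF[OF that]], of "(1, 0)"] by simp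
    then show ?thesis
      using linear_scale[OF linear_frechet_derivative[OF f_differentiable[OF GI(1)[OF that(1)] that(2)]], of "c (G y)" "(1, 0)"] by simp
  qed
  have F10nz: "frechet_derivative F (at (y, a)) (1, 0) \<noteq> 0" if "y \<in> W0" "a \<in> B" for y a
    using F10[OF that] c fx GI that by simp
  define e1 where "e1 a v = c1 * slope f v k a - c2 * slope f v j a" for a v
  \<comment> \<open>The shift \<open>m\<close> of \<open>affine_slope\<close> is absorbed into the
    constant term, so the slope of \<open>F\<close> at \<open>y\<close> becomes
    \<open>e0 a v + y * e1 a v\<close>.\<close>
  define e0 where "e0 a v = d2 * slope f v j a - d1 * slope f v k a + m * e1 a v" for a v
  have pde: "frechet_derivative F (at (y, a)) (0, v) = frechet_derivative F (at (y, a)) (1, 0) * (e0 a v + y * e1 a v)"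
    if "y \<in> W0" "a \<in> B" for y a v
  proof -
    have "frechet_derivative F (at (y, a)) (0, v) = frechet_derivative f (at (G y, a)) (0, v)"
      using fun_cong[OF frechet_derivative_at[OF DF[OF that]], of "(0, v)"] by simp
    also have "\<dots> = frechet_derivative f (at (G y, a)) (1, 0) * slope f v (G y) a"
      using fx[OF GI(1)[OF that(1)] that(2)] by (simp add: slope_def)
    also have "slope f v (G y) a = c (G y) * (e0 a v + y * e1 a v)"
      unfolding aff[OF GI(1)[OF that(1)] that(2)] GI(2)[OF that(1)] e0_def e1_def by algebra
    finally show ?thesis unfolding F10[OF that] by simp
  qed
  have econt: "continuous_on B (\<lambda>a. e0 a v)" "continuous_on B (\<lambda>a. e1 a v)" for v
    unfolding e0_def e1_def by (intro continuous_intros slope_continuous_snd jk)+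
  obtain Mj where Mj: "\<And>a v. a \<in> cball a0 \<beta> \<Longrightarrow> \<bar>slope f v j a\<bar> \<le> Mj * norm v"
    by (rule slope_bounded[OF jk(1) \<beta>(2) compact_cball]) (rule that)
  obtain Mk where Mk: "\<And>a v. a \<in> cball a0 \<beta> \<Longrightarrow> \<bar>slope f v k a\<bar> \<le> Mk * norm v"
    by (rule slope_bounded[OF jk(2) \<beta>(2) compact_cball]) (rule that)
  have comb: "\<bar>u * slope f v j a + w * slope f v k a\<bar> \<le> (\<bar>u\<bar> * Mj + \<bar>w\<bar> * Mk) * norm v"
    if "a \<in> cball a0 \<beta>" for u w a v
  proof -
    have "\<bar>u * slope f v j a + w * slope f v k a\<bar> \<le> \<bar>u\<bar> * \<bar>slope f v j a\<bar> + \<bar>w\<bar> * \<bar>slope f v k a\<bar>"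
      using abs_triangle_ineq[of "u * slope f v j a" "w * slope f v k a"] by (simp add: abs_mult)
    also have "\<dots> \<le> \<bar>u\<bar> * (Mj * norm v) + \<bar>w\<bar> * (Mk * norm v)"
      using Mj[OF that] Mk[OF that] by (intro add_mono mult_left_mono) auto
    finally show ?thesis by (simp add: algebra_simps)
  qed
  define M where "M = max (\<bar>- c2\<bar> * Mj + \<bar>c1\<bar> * Mk) (\<bar>d2 - m * c2\<bar> * Mj + \<bar>m * c1 - d1\<bar> * Mk)"
  have bd: "\<bar>e0 a v\<bar> \<le> M * norm v" "\<bar>e1 a v\<bar> \<le> M * norm v" if "a \<in> ball a0 \<beta>" for a v
  proof -
    have a: "a \<in> cball a0 \<beta>" using that by simp
    have "e0 a v = (d2 - m * c2) * slope f v j a + (m * c1 - d1) * slope f v k a" "e1 a v = - c2 * slope f v j a + c1 * slope f v k a"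
      unfolding e0_def e1_def by algebra+
    then have "\<bar>e0 a v\<bar> \<le> (\<bar>d2 - m * c2\<bar> * Mj + \<bar>m * c1 - d1\<bar> * Mk) * norm v" "\<bar>e1 a v\<bar> \<le> (\<bar>- c2\<bar> * Mj + \<bar>c1\<bar> * Mk) * norm v"
      using comb[OF a] by metis+
    moreover have "(\<bar>d2 - m * c2\<bar> * Mj + \<bar>m * c1 - d1\<bar> * Mk) * norm v \<le> M * norm v" "(\<bar>- c2\<bar> * Mj + \<bar>c1\<bar> * Mk) * norm v \<le> M * norm v"
      unfolding M_def by (intro mult_right_mono max.cobounded1 max.cobounded2 norm_ge_zero)+
    ultimately show "\<bar>e0 a v\<bar> \<le> M * norm v" "\<bar>e1 a v\<bar> \<le> M * norm v" by linarith+
  qed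
  have a0\<beta>: "a0 \<in> ball a0 \<beta>" using \<beta>(1) by simp
  obtain \<delta> where \<delta>: "\<delta> > 0" and char: "\<And>a. a \<in> ball a0 \<beta> \<Longrightarrow> dist a0 a < \<delta> \<Longrightarrow>
      \<exists>\<xi> \<eta>. \<forall>y. \<bar>y\<bar> < \<rho> / 8 \<longrightarrow> \<bar>\<xi> * y + \<eta>\<bar> < \<rho> \<and> F (y, a) = F (\<xi> * y + \<eta>, a0)"
  proof (rule affine_characteristics[OF convex_ball a0\<beta> \<rho>(1)])
    show "F differentiable (at (y, a))" if "\<bar>y\<bar> < \<rho>" "a \<in> ball a0 \<beta>" for y a
      using dF[OF \<rho>W[OF that(1)] \<beta>B[OF that(2)]] .
    show "frechet_derivative F (at (y, a)) (0, v) = frechet_derivative F (at (y, a)) (1, 0) * (e0 a v + y * e1 a v)"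
      if "\<bar>y\<bar> < \<rho>" "a \<in> ball a0 \<beta>" for y a v
      using pde[OF \<rho>W[OF that(1)] \<beta>B[OF that(2)]] .
    show "continuous_on (ball a0 \<beta>) (\<lambda>a. e0 a v)" "continuous_on (ball a0 \<beta>) (\<lambda>a. e1 a v)" for v
      by (rule continuous_on_subset[OF econt(1)] continuous_on_subset[OF econt(2)], use \<beta>B in blast)+
    show "\<bar>e0 a v\<bar> \<le> M * norm v" "\<bar>e1 a v\<bar> \<le> M * norm v" if "a \<in> ball a0 \<beta>" for a v
      using bd[OF that] by blast+
  qed (rule that)
  define B2 where "B2 = ball a0 (min \<beta> \<delta>)"
  have B2: "open B2" "a0 \<in> B2" "B2 \<subseteq> B" using \<beta> \<delta> \<beta>B by (auto simp: B2_def)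
  \<comment> \<open>\<open>affine_characteristics\<close> keeps every value \<xi> y + \<eta> inside
    this interval, so all of them lie in the domain of the scaling \<open>h\<close>.\<close>
  define J where "J = {- \<rho><..<\<rho>}"
  have J: "open J" "is_interval J" "J \<subseteq> W0" using \<rho>W by (auto simp: J_def is_interval_oo)
  define h where "h y = F (y, a0)" for y
  have oWB: "open (W0 \<times> B)" using W0 B by (simp add: open_Times)
  have Crh: "Cr_on r J h"
    unfolding h_def[abs_def]
  proof (rule Cr_on_compose[OF J(1) oWB _ CrF])
    show "(\<lambda>y. (y, a0)) ` J \<subseteq> W0 \<times> B" using J a0 by auto
    show "Cr_on r J (\<lambda>y. (y, a0))" unfolding Cr_on_def by (intro allI impI Ck_on_Pair J Ck_on_ident Ck_on_const)
  qed
  have h': "(h has_real_derivative frechet_derivative F (at (y, a0)) (1, 0)) (at y)" if "y \<in> J" for y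
    using has_real_derivative_along_line[where f=F and x="(0, a0)" and t=y and v="(1, 0)"] dF[of y a0] that J a0
    unfolding h_def[abs_def] by auto
  have h'nz: "deriv h y \<noteq> 0" if "y \<in> J" for y
    using DERIV_imp_deriv[OF h'[OF that]] F10nz[of y a0] that J a0 by auto
  have scal: "scaling_function r J h" using J Crh h'nz by (simp add: scaling_function_def)
  note hinv = Cr_inverse_real[OF r1 J(1,2) Crh h'nz]
  define k' where "k' = the_inv_into J h"
  have k'h: "k' (h y) = y" if "y \<in> J" for y using the_inv_into_f_f[OF hinv(1) that] by (simp add: k'_def)
  have k': "(k' has_real_derivative inverse (frechet_derivative F (at (y, a0)) (1, 0))) (at (h y))" if y: "y \<in> J" for y
  proof (rule has_field_derivative_inverse_basic[where f=h and t="h ` J"])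
    show "(h has_real_derivative frechet_derivative F (at (y, a0)) (1, 0)) (at (k' (h y)))" using h'[OF y] k'h[OF y] by simp
    show "continuous (at (h y)) k'"
      using hinv(2,3) y by (simp add: k'_def homeomorphism_def continuous_on_eq_continuous_at)
    show "h (k' z) = z" if "z \<in> h ` J" for z using that k'h by auto
    show "frechet_derivative F (at (y, a0)) (1, 0) \<noteq> 0" using F10nz[of y a0] y J a0 by auto
  qed (use hinv(2) y in auto)
  \<comment> \<open>An affine function of \<open>y\<close> is determined by its values at 0 and at
    one other point. \<open>\<rho> / 16\<close> is a convenient nonzero point below
    \<open>\<rho> / 8\<close>; \<open>H\<close> is the value at 0 and \<open>Z\<close> the
    difference quotient.\<close>
  define y1 where "y1 = \<rho> / 16"
  define H where "H a = k' (F (0, a))" for a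
  define Z where "Z a = (k' (F (y1, a)) - H a) / y1" for a
  have y1: "y1 \<noteq> 0" "\<bar>y1\<bar> < \<rho> / 8" using \<rho>(1) by (auto simp: y1_def)
  have zero: "\<bar>0::real\<bar> < \<rho> / 8" using \<rho>(1) by simp
  \<comment> \<open>For each \<open>a\<close> the numbers \<xi> and \<eta> are merely known to
    exist; evaluation at 0 and \<open>y1\<close> identifies them with \<open>H a\<close> and
    \<open>Z a\<close>, whose smoothness can be checked.\<close>
  have key: "F (y, a) \<in> h ` J \<and> k' (F (y, a)) = y * Z a + H a" if a: "a \<in> B2" and y: "\<bar>y\<bar> < \<rho> / 8" for a y
  proof -
    obtain \<xi> \<eta> where \<xi>: "\<And>y. \<bar>y\<bar> < \<rho> / 8 \<Longrightarrow> \<bar>\<xi> * y + \<eta>\<bar> < \<rho> \<and> F (y, a) = F (\<xi> * y + \<eta>, a0)"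
      using char[of a] a by (auto simp: B2_def)
    have val: "F (y, a) \<in> h ` J \<and> k' (F (y, a)) = \<xi> * y + \<eta>" if "\<bar>y\<bar> < \<rho> / 8" for y
    proof -
      have "\<xi> * y + \<eta> \<in> J" "F (y, a) = h (\<xi> * y + \<eta>)" using \<xi>[OF that] by (auto simp: J_def h_def)
      then show ?thesis using k'h by simp
    qed
    have "H a = \<eta>" using val[OF zero] by (simp add: H_def)
    moreover have "Z a = \<xi>" using val[OF y1(2)] \<open>H a = \<eta>\<close> y1(1) by (simp add: Z_def)
    ultimately show ?thesis using val[OF y] by (simp add: mult.commute)
  qed
  have CkR: "Ck_on n B2 (\<lambda>a. k' (F (y, a)))" if n: "enat n \<le> r" and y: "\<bar>y\<bar> < \<rho> / 8" for n y
  proof (rule Ck_on_compose[where g=k' and f="\<lambda>a. F (y, a)", OF B2(1) hinv(2)])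
    show "(\<lambda>a. F (y, a)) ` B2 \<subseteq> h ` J" using key y by blast
    show "Ck_on n (h ` J) k'" using hinv(4) n by (simp add: Cr_on_def k'_def)
    show "Ck_on n B2 (\<lambda>a. F (y, a))"
    proof (rule Ck_on_compose[where g=F and f="Pair y", OF B2(1) oWB])
      show "Pair y ` B2 \<subseteq> W0 \<times> B" using \<rho>W[of y] y \<rho>(1) B2 by auto
      show "Ck_on n (W0 \<times> B) F" using CrF n by (simp add: Cr_on_def)
      show "Ck_on n B2 (Pair y)" by (intro Ck_on_Pair B2 Ck_on_const Ck_on_ident)
    qed
  qed
  define \<Psi> where "\<Psi> a = (Z a, H a)" for a
  have Cr\<Psi>: "Cr_on r B2 \<Psi>"
    unfolding Cr_on_def \<Psi>_def[abs_def] Z_def H_def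
    by (intro allI impI Ck_on_Pair Ck_on_divide Ck_on_diff Ck_on_const CkR B2 y1 zero)
  \<comment> \<open>At \<open>a0\<close> the derivative of \<open>k'\<close> is the reciprocal of
    that of \<open>F\<close> in its first variable, which cancels the same factor in
    \<open>pde\<close>.\<close>
  have R': "((\<lambda>a. k' (F (y, a))) has_derivative (\<lambda>v. e0 a0 v + y * e1 a0 v)) (at a0)" if y: "\<bar>y\<bar> < \<rho> / 8" for y
  proof -
    have yJ: "y \<in> J" "y \<in> W0" using y \<rho> \<rho>W[of y] by (auto simp: J_def)
    have "((\<lambda>a. (y, a)) has_derivative (\<lambda>v. (0, v))) (at a0)" by (auto intro!: derivative_eq_intros)
    moreover have "(F has_derivative frechet_derivative F (at (y, a0))) (at (y, a0))"
      using dF[OF yJ(2) a0] by (simp add: frechet_derivative_works)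
    ultimately have "((\<lambda>a. F (y, a)) has_derivative (\<lambda>v. frechet_derivative F (at (y, a0)) (0, v))) (at a0)"
      by (rule has_derivative_compose)
    from has_derivative_compose[OF this, of k'] k'[OF yJ(1)]
    have "((\<lambda>a. k' (F (y, a))) has_derivative (\<lambda>v. inverse (frechet_derivative F (at (y, a0)) (1, 0)) * frechet_derivative F (at (y, a0)) (0, v))) (at a0)"
      by (simp add: has_field_derivative_def h_def)
    then show ?thesis
      unfolding pde[OF yJ(2) a0] mult.assoc[symmetric] left_inverse[OF F10nz[OF yJ(2) a0]] mult_1_left .
  qed
  have H': "(H has_derivative e0 a0) (at a0)" unfolding H_def[abs_def] using R'[OF zero] by simp
  have "(Z has_derivative (\<lambda>v. (e0 a0 v + y1 * e1 a0 v - e0 a0 v) / y1)) (at a0)"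
    unfolding Z_def[abs_def] divide_inverse by (intro has_derivative_mult_left has_derivative_diff R'[OF y1(2)] H')
  then have "(Z has_derivative e1 a0) (at a0)" using y1(1) by simp
  from frechet_derivative_at[OF has_derivative_Pair[OF this H']]
  have fr\<Psi>: "frechet_derivative \<Psi> (at a0) = (\<lambda>v. (e1 a0 v, e0 a0 v))" by (simp add: \<Psi>_def[abs_def])
  \<comment> \<open>The summand \<open>m * e1\<close> of \<open>e0\<close> drops out of the
    determinant; the rest is the change of basis from the slopes of \<open>j\<close> and
    \<open>k\<close>.\<close>
  have "jacobian_det \<Psi> a0 = - ((c1 * d2 - c2 * d1) * slope_det f a0 j k)"
    unfolding jacobian_det_def Let_def fr\<Psi> fst_conv snd_conv e0_def e1_def slope_det_def by algebra
  then have "jacobian_det \<Psi> a0 \<noteq> 0" using cd det[OF jk a0] by simp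
  then obtain U V g where U: "open U" "a0 \<in> U" "U \<subseteq> B2" "open V" "homeomorphism U V \<Psi> g" "Cr_on r V g"
    using Cr_local_inverse_plane[OF r1 B2(1,2) Cr\<Psi>] by blast
  define I' where "I' = {x \<in> I. \<bar>X x\<bar> < \<rho> / 8}"
  have oI': "open I'"
  proof -
    have "open (I \<inter> X -` ball 0 (\<rho> / 8))"
      using hom I(1) by (intro continuous_open_preimage) (auto simp: homeomorphism_def)
    moreover have "I \<inter> X -` ball 0 (\<rho> / 8) = I'" by (auto simp: I'_def)
    ultimately show ?thesis by simp
  qed
  have XI': "X ` I' = ball 0 (\<rho> / 8)"
  proof
    show "ball 0 (\<rho> / 8) \<subseteq> X ` I'"
    proof
      fix y :: real assume "y \<in> ball 0 (\<rho> / 8)"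
      then have y: "\<bar>y\<bar> < \<rho> / 8" "y \<in> W0" using \<rho>W[of y] \<rho>(1) by auto
      then have "G y \<in> I'" "X (G y) = y" using GI[OF y(2)] by (auto simp: I'_def)
      then show "y \<in> X ` I'" by force
    qed
  qed (auto simp: I'_def)
  have subW: "ball 0 (\<rho> / 8) \<subseteq> W0" using \<rho>W \<rho>(1) by auto
  show thesis
  proof (rule that)
    show "open I'" "x0 \<in> I'" "I' \<subseteq> I" using oI' x0 X0 \<rho>(1) by (auto simp: I'_def)
    then show "homeomorphism I' (ball 0 (\<rho> / 8)) X G"
      using homeomorphism_of_subsets[OF hom _ subW XI'] by blast
    show "Cr_on r I' X" using Cr_on_subset[OF CrX \<open>I' \<subseteq> I\<close>] .
    show "Cr_on r (ball 0 (\<rho> / 8)) G" using Cr_on_subset[OF CrG subW] .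
    show "Cr_on r U \<Psi>" using Cr_on_subset[OF Cr\<Psi> U(3)] .
    show "U \<subseteq> B" using U B2 by blast
    show "f (x, a) \<in> h ` J \<and> the_inv_into J h (f (x, a)) = X x * fst (\<Psi> a) + snd (\<Psi> a)" if "x \<in> I'" "a \<in> U" for x a
    proof -
      have "x \<in> I" "\<bar>X x\<bar> < \<rho> / 8" "a \<in> B2" using that U(3) by (auto simp: I'_def)
      moreover from this have "F (X x, a) = f (x, a)" using GX by (simp add: F_def)
      ultimately show ?thesis using key[of a "X x"] by (simp add: k'_def \<Psi>_def)
    qed
  qed (use U scal in simp_all)
qed

end

section \<open>Passage to manifolds\<close>

text \<open>Translates the one-variable derivatives of axiom A3 into the Frechet derivatives that
  define slopes.\<close>

lemma deriv_partials:
  fixes f :: "real \<times> real \<times> real \<Rightarrow> real"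
  assumes "f differentiable (at (x, s, t))"
  shows "deriv (\<lambda>u. f (u, s, t)) x = frechet_derivative f (at (x, s, t)) (1, 0)"
    and "deriv (\<lambda>u. f (x, u, t)) s = frechet_derivative f (at (x, s, t)) (0, 1, 0)"
    and "deriv (\<lambda>u. f (x, s, u)) t = frechet_derivative f (at (x, s, t)) (0, 0, 1)"
proof -
  have "((\<lambda>u. f (u, s, t)) has_real_derivative frechet_derivative f (at (x, s, t)) (1, 0)) (at x)"
    using has_real_derivative_along_line[where f=f and x="(0, s, t)" and t=x and v="(1, 0)"] assms
    by (simp add: zero_prod_def)
  then show "deriv (\<lambda>u. f (u, s, t)) x = frechet_derivative f (at (x, s, t)) (1, 0)" by (rule DERIV_imp_deriv)
  have "((\<lambda>u. f (x, u, t)) has_real_derivative frechet_derivative f (at (x, s, t)) (0, 1, 0)) (at s)"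
    using has_real_derivative_along_line[where f=f and x="(x, 0, t)" and t=s and v="(0, 1, 0)"] assms by simp
  then show "deriv (\<lambda>u. f (x, u, t)) s = frechet_derivative f (at (x, s, t)) (0, 1, 0)" by (rule DERIV_imp_deriv)
  have "((\<lambda>u. f (x, s, u)) has_real_derivative frechet_derivative f (at (x, s, t)) (0, 0, 1)) (at t)"
    using has_real_derivative_along_line[where f=f and x="(x, s, 0)" and t=t and v="(0, 0, 1)"] assms by simp
  then show "deriv (\<lambda>u. f (x, s, u)) t = frechet_derivative f (at (x, s, t)) (0, 0, 1)" by (rule DERIV_imp_deriv)
qed

lemma chart_vimage_open:
  assumes "is_chart (U, \<phi>)" "open S" "S \<subseteq> \<phi> ` U"
  shows "open (U \<inter> \<phi> -` S)" "\<phi> ` (U \<inter> \<phi> -` S) = S"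
proof -
  have "open U" "continuous_on U \<phi>" using assms(1) by (auto simp: is_chart_def homeomorphism_def)
  then show "open (U \<inter> \<phi> -` S)" using assms(2) by (simp add: continuous_open_preimage)
  show "\<phi> ` (U \<inter> \<phi> -` S) = S" using assms(3) by auto
qed

lemma inj_on_vimage_subset:
  assumes "inj_on f S" "N \<subseteq> f ` (S \<inter> T)"
  shows "S \<inter> f -` N \<subseteq> T"
proof
  fix x assume x: "x \<in> S \<inter> f -` N"
  then obtain y where "y \<in> S \<inter> T" "f x = f y" using assms(2) by blast
  then show "x \<in> T" using x inj_onD[OF assms(1), of x y] by simp
qed

lemma chart_around:
  assumes "Cr_atlas r A"
  obtains U \<phi> where "(U, \<phi>) \<in> A" "x \<in> U"
proof -
  have "x \<in> (\<Union>c\<in>A. fst c)" using assms by (auto simp: Cr_atlas_def)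
  then show thesis using that by auto
qed

text \<open>Joint continuity in both points and in \<open>a\<close> is what makes the relation
  between minors a closed condition.\<close>

lemma (in regular_representation) slope_det_continuous:
  "continuous_on (I \<times> I \<times> B) (\<lambda>(x, y, a). slope_det f a x y)"
proof -
  have "enat (Suc 0) \<le> r" using r by (metis One_nat_def one_enat_def one_le_numeral order_trans)
  from Ck_on_imp_continuous_on[OF slope_Ck[OF this]]
  have c: "continuous_on (I \<times> B) (\<lambda>z. slope f v (fst z) (snd z))" for v .
  have "continuous_on (I \<times> I \<times> B) (\<lambda>z. slope f v (fst (fst z, snd (snd z))) (snd (fst z, snd (snd z))))" for v
    by (rule continuous_on_compose2[OF c, where f="\<lambda>z. (fst z, snd (snd z))"]) (auto intro!: continuous_intros)
  moreover have "continuous_on (I \<times> I \<times> B) (\<lambda>z. slope f v (fst (fst (snd z), snd (snd z))) (snd (fst (snd z), snd (snd z))))" for v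
    by (rule continuous_on_compose2[OF c, where f="\<lambda>z. (fst (snd z), snd (snd z))"]) (auto intro!: continuous_intros)
  ultimately show ?thesis
    unfolding slope_det_def case_prod_beta by (auto intro!: continuous_intros)
qed

text \<open>The relation between the minors is a closed condition, so it suffices to have it on the dense
  set of tuples at which the hypersurface is non-degenerate.\<close>

lemma coordinate_slope_geometry:
  fixes A :: "('m::{t2_space,second_countable_topology}, real) chart set"
    and B :: "('n::{t2_space,second_countable_topology}, real \<times> real) chart set"
  assumes r: "2 \<le> r" and A: "Cr_atlas r A" and B: "Cr_atlas r B" and ps: "PS_G2S_3_2 r A B D f"
    and c: "(U, \<phi>) \<in> A" and d: "(V, \<psi>) \<in> B"
    and I: "open I" "is_interval I" "I \<subseteq> \<phi> ` U" and S: "open S" "S \<subseteq> \<psi> ` V"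
    and D: "(U \<inter> \<phi> -` I) \<times> (V \<inter> \<psi> -` S) \<subseteq> D"
  shows "slope_geometry r I S (coord_rep (U, \<phi>) (V, \<psi>) f)"
proof -
  define e where "e = the_inv_into U \<phi>"
  define e' where "e' = the_inv_into V \<psi>"
  define g where "g = coord_rep (U, \<phi>) (V, \<psi>) f"
  have chU: "is_chart (U, \<phi>)" and chV: "is_chart (V, \<psi>)" using A B c d by (auto simp: Cr_atlas_def)
  have inj: "inj_on \<phi> U" "inj_on \<psi> V" and opUV: "open U" "open V" and cont: "continuous_on U \<phi>" "continuous_on V \<psi>"
    using chU chV by (auto simp: is_chart_def homeomorphism_def)
  have e: "e x \<in> U" "\<phi> (e x) = x" if "x \<in> I" for x
    using that I(3) the_inv_into_into[OF inj(1), of x U] f_the_inv_into_f[OF inj(1), of x] by (auto simp: e_def)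
  have e': "e' a \<in> V" "\<psi> (e' a) = a" if "a \<in> S" for a
    using subsetD[OF S(2) that] the_inv_into_into[OF inj(2), of a V] f_the_inv_into_f[OF inj(2), of a] by (simp_all add: e'_def)
  have eD: "(e x, e' a) \<in> D" if "x \<in> I" "a \<in> S" for x a
    using D e[OF that(1)] e'[OF that(2)] that by auto
  have g: "g (x, a) = f (e x) (e' a)" for x a
    by (cases a) (simp add: g_def coord_rep_def e_def e'_def)
  have gm: "g (\<phi> i, \<psi> \<alpha>) = f i \<alpha>" if "i \<in> U" "\<alpha> \<in> V" for i \<alpha>
    using that inj by (simp add: g e_def e'_def the_inv_into_f_f)
  have dom: "(x, a) \<in> coord_dom (U, \<phi>) (V, \<psi>) D" if "x \<in> I" "a \<in> S" for x a
    unfolding coord_dom_def case_prod_conv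
    using eD[OF that] e[OF that(1)] e'[OF that(2)] by (intro image_eqI[of _ _ "(e x, e' a)"]) auto
  have A2: "Cr_on r (coord_dom (U, \<phi>) (V, \<psi>) D) g"
    using ps c d unfolding PS_G2S_3_2_def axiom_A2_def g_def by blast
  have Crg: "Cr_on r (I \<times> S) g" by (rule Cr_on_subset[OF A2]) (use dom in auto)
  then have "Ck_on 2 (I \<times> S) g" using r unfolding Cr_on_def by (metis numeral_eq_enat)
  then have dg: "g differentiable (at (x, a))" if "x \<in> I" "a \<in> S" for x a
    using that by (simp add: numeral_2_eq_2)
  have A3: "axiom_A3 A B D f" using ps by (simp add: PS_G2S_3_2_def)
  have gx: "frechet_derivative g (at (x, a)) (1, 0) \<noteq> 0" if xa: "x \<in> I" "a \<in> S" for x a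
  proof -
    obtain s t where a: "a = (s, t)" by fastforce
    have "\<forall>(x, \<xi>, \<eta>)\<in>coord_dom (U, \<phi>) (V, \<psi>) D. deriv (\<lambda>t. g (t, \<xi>, \<eta>)) x \<noteq> 0"
      using A3 c d unfolding axiom_A3_def g_def by blast
    then have "deriv (\<lambda>u. g (u, s, t)) x \<noteq> 0" using dom[OF xa] unfolding a by auto
    then show ?thesis using deriv_partials(1)[of g x s t] dg[OF xa] unfolding a by simp
  qed
  note Isub = I(3)
  interpret regular_representation r I S g
    by unfold_locales (use r I S Crg gx in auto)
  have gdet: "slope_det g a x y \<noteq> 0" if xy: "x \<in> I" "y \<in> I" "x \<noteq> y" and aS: "a \<in> S" for x y a
  proof -
    obtain s t where a: "a = (s, t)" by fastforce
    have "\<forall>j\<in>U. \<forall>k\<in>U. \<forall>\<alpha>\<in>V. j \<noteq> k \<and> (j, \<alpha>) \<in> D \<and> (k, \<alpha>) \<in> D \<longrightarrow>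
        jacobian2 (\<lambda>\<xi> \<eta>. g (\<phi> j, \<xi>, \<eta>)) (\<lambda>\<xi> \<eta>. g (\<phi> k, \<xi>, \<eta>)) (fst (\<psi> \<alpha>)) (snd (\<psi> \<alpha>)) \<noteq> 0"
      using A3 c d unfolding axiom_A3_def g_def by fast
    moreover have "e x \<noteq> e y" using xy e by metis
    ultimately have "jacobian2 (\<lambda>\<xi> \<eta>. g (\<phi> (e x), \<xi>, \<eta>)) (\<lambda>\<xi> \<eta>. g (\<phi> (e y), \<xi>, \<eta>)) (fst (\<psi> (e' a))) (snd (\<psi> (e' a))) \<noteq> 0"
      using e(1)[OF xy(1)] e(1)[OF xy(2)] e'(1)[OF aS] eD[OF xy(1) aS] eD[OF xy(2) aS] by blast
    then have "jacobian2 (\<lambda>\<xi> \<eta>. g (x, \<xi>, \<eta>)) (\<lambda>\<xi> \<eta>. g (y, \<xi>, \<eta>)) s t \<noteq> 0"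
      by (simp add: e xy e' aS) (simp add: a)
    moreover have "jacobian2 (\<lambda>\<xi> \<eta>. g (x, \<xi>, \<eta>)) (\<lambda>\<xi> \<eta>. g (y, \<xi>, \<eta>)) s t =
      frechet_derivative g (at (x, a)) (1, 0) * frechet_derivative g (at (y, a)) (1, 0) * slope_det g a x y"
      using gx[OF xy(1) aS] gx[OF xy(2) aS] dg[OF xy(1) aS] dg[OF xy(2) aS]
      unfolding jacobian2_def slope_det_def slope_def a
      by (simp add: deriv_partials right_diff_distrib)
    ultimately show ?thesis by auto
  qed
  obtain W and \<Phi> :: "R6 \<Rightarrow> real" where W: "open W" "F_map f ` F_dom D \<subseteq> W" and \<Phi>: "Cr_on r W \<Phi>"
    and \<Phi>0: "\<And>t. t \<in> F_dom D \<Longrightarrow> \<Phi> (F_map f t) = 0"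
    and dense: "F_dom D \<subseteq> closure {t \<in> F_dom D. frechet_derivative \<Phi> (at (F_map f t)) \<noteq> (\<lambda>_. 0)}"
    using ps unfolding PS_G2S_3_2_def axiom_A4_def by blast
  have "Ck_on (Suc 0) W \<Phi>" using \<Phi> r unfolding Cr_on_def by (metis One_nat_def one_enat_def one_le_numeral order_trans)
  note d\<Phi> = Ck_on_SucE[OF this]
  have FD: "(e i, e j, e k, e' a, e' b) \<in> F_dom D" if "i \<in> I" "j \<in> I" "k \<in> I" "a \<in> S" "b \<in> S" for i j k a b
    using that eD by (auto simp: F_dom_def)
  have Fm: "F_map f (e i, e j, e k, e' a, e' b) = (g (i, a), g (i, b), g (j, a), g (j, b), g (k, a), g (k, b))" for i j k a b
    by (simp add: F_map_def g)
  have \<Phi>g: "\<Phi> (g (i, a), g (i, b), g (j, a), g (j, b), g (k, a), g (k, b)) = 0"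
    if "i \<in> I" "j \<in> I" "k \<in> I" "a \<in> S" "b \<in> S" for i j k a b
    using \<Phi>0[OF FD[OF that]] by (simp add: Fm)
  \<comment> \<open>The product of differences lets the single open condition that \<open>E\<close>
    is nonzero express both that the relation fails and that the three points are distinct.\<close>
  define E where "E = (\<lambda>(i, j, k, a, b). (slope_det g a j k * slope_det g b k i - slope_det g a k i * slope_det g b j k)
      * ((i - j) * (j - k) * (k - i)))"
  have Econt: "continuous_on (I \<times> I \<times> I \<times> S \<times> S) E"
  proof -
    let ?S5 = "I \<times> I \<times> I \<times> S \<times> S"
    have c: "continuous_on ?S5 (\<lambda>z. slope_det g (q3 z) (q1 z) (q2 z))"
      if "continuous_on ?S5 q1" "continuous_on ?S5 q2" "continuous_on ?S5 q3"
        "q1 ` ?S5 \<subseteq> I" "q2 ` ?S5 \<subseteq> I" "q3 ` ?S5 \<subseteq> S" for q1 q2 q3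
    proof -
      have "continuous_on ?S5 (\<lambda>z. (\<lambda>(x, y, a). slope_det g a x y) (q1 z, q2 z, q3 z))"
        using slope_det_continuous
        by (rule continuous_on_compose2[where f="\<lambda>z. (q1 z, q2 z, q3 z)"])
          (use that in \<open>auto intro!: continuous_intros simp: image_subset_iff\<close>)
      then show ?thesis by simp
    qed
    show ?thesis
      unfolding E_def case_prod_beta
      by (intro continuous_intros c) auto
  qed
  have rel: "slope_det g a j k * slope_det g b k i = slope_det g a k i * slope_det g b j k"
    if i: "i \<in> I" "j \<in> I" "k \<in> I" "i \<noteq> j" "j \<noteq> k" "k \<noteq> i" and ab: "a \<in> S" "b \<in> S" for i j k a b
  \<comment> \<open>A counterexample has an open neighbourhood of tuples with \<open>E\<close>
    nonzero. It lies in the closure of the nondegenerate tuples, so this neighbourhood contains a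
    nondegenerate one, where \<open>slope_det_relation\<close> contradicts the failure.\<close>
  proof (rule ccontr)
    assume "\<not> ?thesis"
    then have E0: "E (i, j, k, a, b) \<noteq> 0" using i by (simp add: E_def)
    let ?P = "\<lambda>(i, j, k, \<alpha>, \<beta>). (\<phi> i, \<phi> j, \<phi> k, \<psi> \<alpha>, \<psi> \<beta>)"
    let ?U = "U \<inter> \<phi> -` I" and ?V = "V \<inter> \<psi> -` S"
    let ?M = "?U \<times> ?U \<times> ?U \<times> ?V \<times> ?V"
    have oU: "open ?U" "open ?V" using chart_vimage_open[OF chU I(1) Isub] chart_vimage_open[OF chV S] by auto
    have cU: "continuous_on ?U \<phi>" "continuous_on ?V \<psi>" using cont continuous_on_subset by blast+
    have q: "continuous_on ?M (\<lambda>z. \<phi> (q z))" if "continuous_on ?M q" "q ` ?M \<subseteq> ?U" for q :: "_ \<Rightarrow> 'm"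
      using continuous_on_compose2[OF cU(1) that] .
    have q': "continuous_on ?M (\<lambda>z. \<psi> (q z))" if "continuous_on ?M q" "q ` ?M \<subseteq> ?V" for q :: "_ \<Rightarrow> 'n"
      using continuous_on_compose2[OF cU(2) that] .
    have Pc: "continuous_on ?M ?P"
      unfolding case_prod_beta
      by (intro continuous_on_Pair q q' continuous_on_fst continuous_on_snd continuous_on_id) auto
    have "continuous_on ?M (\<lambda>t. E (?P t))"
      by (rule continuous_on_compose2[OF Econt Pc]) auto
    moreover have "open ?M" using oU by (intro open_Times)
    ultimately have oN: "open (?M \<inter> (\<lambda>t. E (?P t)) -` (- {0}))" by (rule continuous_open_preimage) auto
    have "(e i, e j, e k, e' a, e' b) \<in> ?M \<inter> (\<lambda>t. E (?P t)) -` (- {0})"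
      using i ab e e' E0 by simp
    moreover have "(e i, e j, e k, e' a, e' b) \<in> closure {t \<in> F_dom D. frechet_derivative \<Phi> (at (F_map f t)) \<noteq> (\<lambda>_. 0)}"
      using dense FD[OF i(1-3) ab] by blast
    ultimately have "?M \<inter> (\<lambda>t. E (?P t)) -` (- {0}) \<inter> {t \<in> F_dom D. frechet_derivative \<Phi> (at (F_map f t)) \<noteq> (\<lambda>_. 0)} \<noteq> {}"
      using open_Int_closure_eq_empty[OF oN] by blast
    then obtain t where t: "t \<in> ?M" "E (?P t) \<noteq> 0" "t \<in> F_dom D" "frechet_derivative \<Phi> (at (F_map f t)) \<noteq> (\<lambda>_. 0)"
      by blast
    obtain i' j' k' \<alpha> \<beta> where t': "t = (i', j', k', \<alpha>, \<beta>)" by (cases t)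
    have in5: "\<phi> i' \<in> I" "\<phi> j' \<in> I" "\<phi> k' \<in> I" "\<psi> \<alpha> \<in> S" "\<psi> \<beta> \<in> S"
      and inU: "i' \<in> U" "j' \<in> U" "k' \<in> U" "\<alpha> \<in> V" "\<beta> \<in> V" using t(1) t' by auto
    have ne: "\<phi> i' \<noteq> \<phi> j'" "\<phi> j' \<noteq> \<phi> k'" "\<phi> k' \<noteq> \<phi> i'"
      and Ene: "slope_det g (\<psi> \<alpha>) (\<phi> j') (\<phi> k') * slope_det g (\<psi> \<beta>) (\<phi> k') (\<phi> i') \<noteq> slope_det g (\<psi> \<alpha>) (\<phi> k') (\<phi> i') * slope_det g (\<psi> \<beta>) (\<phi> j') (\<phi> k')"
      using t(2) by (auto simp: t' E_def)
    have Ft: "F_map f t = (g (\<phi> i', \<psi> \<alpha>), g (\<phi> i', \<psi> \<beta>), g (\<phi> j', \<psi> \<alpha>), g (\<phi> j', \<psi> \<beta>), g (\<phi> k', \<psi> \<alpha>), g (\<phi> k', \<psi> \<beta>))"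
      using inU by (simp add: t' F_map_def gm)
    have "(\<Phi> has_derivative frechet_derivative \<Phi> (at (F_map f t))) (at (F_map f t))"
      using W(2) t(3) by (intro d\<Phi>) auto
    from slope_det_relation[OF I(1) in5(1-3) S(1) in5(4,5) dg gx gdet[OF in5(2,3) ne(2) in5(4)] gdet[OF in5(3,1) ne(3) in5(4)] \<Phi>g this[unfolded Ft] t(4)[unfolded Ft]]
    show False using Ene by blast
  qed
  show ?thesis unfolding g_def[symmetric]
    by unfold_locales (use gdet rel in blast)+
qed

theorem mainTheorem1:
  fixes r :: enat
    and A :: "('m::{t2_space,second_countable_topology}, real) chart set"
    and B :: "('n::{t2_space,second_countable_topology}, real \<times> real) chart set"
    and D :: "('m \<times> 'n) set"
    and f :: "'m \<Rightarrow> 'n \<Rightarrow> real"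
  assumes "2 \<le> r"
    and "Cr_atlas r A"
    and "Cr_atlas r B"
    and "PS_G2S_3_2 r A B D f"
  shows "\<forall>(i\<^sub>0, \<alpha>\<^sub>0)\<in>D. \<exists>U x V \<xi> \<eta> J h.
           local_coords r A (U, x) \<and> i\<^sub>0 \<in> U \<and>
           local_coords r B (V, \<lambda>\<alpha>. (\<xi> \<alpha>, \<eta> \<alpha>)) \<and> \<alpha>\<^sub>0 \<in> V \<and>
           U \<times> V \<subseteq> D \<and>
           scaling_function r J h \<and>
           (\<forall>i\<in>U. \<forall>\<alpha>\<in>V. f i \<alpha> \<in> h ` J \<and>
              the_inv_into J h (f i \<alpha>) = x i * \<xi> \<alpha> + \<eta> \<alpha>)"
proof (intro ballI, clarify)
  fix i0 :: 'm and \<alpha>0 :: 'n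
  assume iD: "(i0, \<alpha>0) \<in> D"
  obtain U0 \<phi> where c: "(U0, \<phi>) \<in> A" "i0 \<in> U0" by (rule chart_around[OF assms(2)])
  obtain V0 \<psi> where d: "(V0, \<psi>) \<in> B" "\<alpha>0 \<in> V0" by (rule chart_around[OF assms(3)])
  have ch: "is_chart (U0, \<phi>)" "is_chart (V0, \<psi>)" using assms(2,3) c d by (auto simp: Cr_atlas_def)
  then have UV0: "open U0" "open V0" and inj: "inj_on \<phi> U0" "inj_on \<psi> V0" by (auto simp: is_chart_def)
  have "open D" using assms(4) by (simp add: PS_G2S_3_2_def axiom_A1_def)
  then obtain U1 V1 where UV1: "open U1" "open V1" "i0 \<in> U1" "\<alpha>0 \<in> V1" "U1 \<times> V1 \<subseteq> D"
    using iD by (auto elim!: open_prod_elim)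
  have "open (\<phi> ` (U0 \<inter> U1))" "open (\<psi> ` (V0 \<inter> V1))"
    using chart_image_open[OF ch(1)] chart_image_open[OF ch(2)] UV0 UV1 by (simp_all add: open_Int)
  moreover have "\<phi> i0 \<in> \<phi> ` (U0 \<inter> U1)" "\<psi> \<alpha>0 \<in> \<psi> ` (V0 \<inter> V1)" using c d UV1 by auto
  ultimately obtain e e' where e: "e > 0" "ball (\<phi> i0) e \<subseteq> \<phi> ` (U0 \<inter> U1)" and e': "e' > 0" "ball (\<psi> \<alpha>0) e' \<subseteq> \<psi> ` (V0 \<inter> V1)"
    by (meson openE)
  \<comment> \<open>On the real line a ball is an interval, as the global inversion of
    \<open>X\<close> and the mean value argument behind it require.\<close>
  let ?I = "ball (\<phi> i0) e" and ?S = "ball (\<psi> \<alpha>0) e'"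
  \<comment> \<open>The balls were chosen in images of subsets of \<open>U1\<close> and
    \<open>V1\<close>; injectivity of the charts brings their preimages back there, hence into
    \<open>D\<close>.\<close>
  have sub: "U0 \<inter> \<phi> -` ?I \<subseteq> U1" "V0 \<inter> \<psi> -` ?S \<subseteq> V1"
    by (rule inj_on_vimage_subset[OF inj(1) e(2)] inj_on_vimage_subset[OF inj(2) e'(2)])+
  interpret slope_geometry r ?I ?S "coord_rep (U0, \<phi>) (V0, \<psi>) f"
  proof (rule coordinate_slope_geometry[OF assms c(1) d(1)])
    show "is_interval ?I" by (simp add: ball_eq_greaterThanLessThan is_interval_oo)
    show "(U0 \<inter> \<phi> -` ?I) \<times> (V0 \<inter> \<psi> -` ?S) \<subseteq> D" using sub UV1(5) by blast
  qed (use e e' in auto)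
  obtain I' X G W B' \<Psi> \<Psi>' V' J h where
    I': "open I'" "\<phi> i0 \<in> I'" "I' \<subseteq> ?I" "open W" "homeomorphism I' W X G" "Cr_on r I' X" "Cr_on r W G"
    and B': "open B'" "\<psi> \<alpha>0 \<in> B'" "B' \<subseteq> ?S" "open V'" "homeomorphism B' V' \<Psi> \<Psi>'" "Cr_on r B' \<Psi>" "Cr_on r V' \<Psi>'"
    and h: "scaling_function r J h"
    and form: "\<And>x a. x \<in> I' \<Longrightarrow> a \<in> B' \<Longrightarrow> coord_rep (U0, \<phi>) (V0, \<psi>) f (x, a) \<in> h ` J \<and>
      the_inv_into J h (coord_rep (U0, \<phi>) (V0, \<psi>) f (x, a)) = X x * fst (\<Psi> a) + snd (\<Psi> a)"
    by (rule canonical_form[of "\<phi> i0" "\<psi> \<alpha>0"]) (use e e' in simp, use e e' in simp, rule that, assumption+)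
  let ?U = "U0 \<inter> \<phi> -` I'" and ?V = "V0 \<inter> \<psi> -` B'"
  have U: "open ?U" "\<phi> ` ?U = I'"
  proof -
    have "I' \<subseteq> \<phi> ` U0" using I'(3) e(2) by blast
    from chart_vimage_open[OF ch(1) I'(1) this] show "open ?U" "\<phi> ` ?U = I'" .
  qed
  have V: "open ?V" "\<psi> ` ?V = B'"
  proof -
    have "B' \<subseteq> \<psi> ` V0" using B'(3) e'(2) by blast
    from chart_vimage_open[OF ch(2) B'(1) this] show "open ?V" "\<psi> ` ?V = B'" .
  qed
  have 1: "local_coords r A (?U, X \<circ> \<phi>)"
    by (rule local_coords_reparametrize[OF assms(2) c(1) U(1), where W=W and G=G]) (use I' in \<open>simp_all only: U Int_lower1\<close>)
  have 2: "local_coords r B (?V, \<Psi> \<circ> \<psi>)"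
    by (rule local_coords_reparametrize[OF assms(3) d(1) V(1), where W=V' and G=\<Psi>']) (use B' in \<open>simp_all only: V Int_lower1\<close>)
  have \<Psi>: "(\<lambda>\<alpha>. (fst (\<Psi> (\<psi> \<alpha>)), snd (\<Psi> (\<psi> \<alpha>)))) = \<Psi> \<circ> \<psi>" by auto
  have rep: "coord_rep (U0, \<phi>) (V0, \<psi>) f (\<phi> i, \<psi> \<alpha>) = f i \<alpha>" if "i \<in> U0" "\<alpha> \<in> V0" for i \<alpha>
    using that inj by (cases "\<psi> \<alpha>") (auto simp: coord_rep_def the_inv_into_f_f dest: sym)
  show "\<exists>U x V \<xi> \<eta> J h.
           local_coords r A (U, x) \<and> i0 \<in> U \<and>
           local_coords r B (V, \<lambda>\<alpha>. (\<xi> \<alpha>, \<eta> \<alpha>)) \<and> \<alpha>0 \<in> V \<and>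
           U \<times> V \<subseteq> D \<and>
           scaling_function r J h \<and>
           (\<forall>i\<in>U. \<forall>\<alpha>\<in>V. f i \<alpha> \<in> h ` J \<and>
              the_inv_into J h (f i \<alpha>) = x i * \<xi> \<alpha> + \<eta> \<alpha>)"
  proof (intro exI conjI)
    show "local_coords r A (?U, X \<circ> \<phi>)" by (rule 1)
    show "local_coords r B (?V, \<lambda>\<alpha>. (fst (\<Psi> (\<psi> \<alpha>)), snd (\<Psi> (\<psi> \<alpha>))))" unfolding \<Psi> by (rule 2)
    show "i0 \<in> ?U" "\<alpha>0 \<in> ?V" using c d I' B' by auto
    show "?U \<times> ?V \<subseteq> D" using sub I'(3) B'(3) UV1(5) by blast
    show "scaling_function r J h" by (rule h)
    show "\<forall>i\<in>?U. \<forall>\<alpha>\<in>?V. f i \<alpha> \<in> h ` J \<and>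
        the_inv_into J h (f i \<alpha>) = (X \<circ> \<phi>) i * fst (\<Psi> (\<psi> \<alpha>)) + snd (\<Psi> (\<psi> \<alpha>))"
    proof (intro ballI)
      fix i \<alpha> assume "i \<in> ?U" "\<alpha> \<in> ?V"
      then have "\<phi> i \<in> I'" "\<psi> \<alpha> \<in> B'" "i \<in> U0" "\<alpha> \<in> V0" by auto
      from form[OF this(1,2)] rep[OF this(3,4)]
      show "f i \<alpha> \<in> h ` J \<and> the_inv_into J h (f i \<alpha>) = (X \<circ> \<phi>) i * fst (\<Psi> (\<psi> \<alpha>)) + snd (\<Psi> (\<psi> \<alpha>))"
        by simp
    qed
  qed
qed

end
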